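(* Assume that a probability measure $\mu$ on $\mathbb{R}^N$ satisfies $\mathbf{LS}_q$ with some $q\in(1,2]$, i.e. there is $c\in(0,\infty)$ such that $$\mu\Big(|g|^q\log\frac{|g|^q}{\mu|g|^q}\Big)\le c\,\mu|\nabla g|^q$$ for all $g\in\mathcal{L}$ with $\mu|g|^q<\infty$. Suppose that $f\in\mathcal{L}$ and that for some constants $a,b\in(0,\infty)$ we have $$|\nabla f|^q\le af+b .$$ Then the following exponential bound is true: $$\mu\,e^{tf}<\infty$$ for all $t>0$ sufficiently small.
   Context: Setting. $\nabla=(X_1,\dots,X_k)$ is a finite collection of smooth, possibly noncommuting, vector fields on $\mathbb{R}^N$; $\nabla f=(X_1f,\dots,X_kf)$, $|\nabla f|=(\sum_i (X_if)^2)^{1/2}$. $\mathcal{L}$ denotes the class of continuous functions $f:\mathbb{R}^N\to\mathbb{R}$ whose distributional derivatives $X_if$ are all in $L^\infty_{loc}$. $\mu$ is absolutely continuous with respect to Lebesgue measure; pointwise inequalities for gradients hold almost everywhere. Notation: $\mu g=\int g\,d\mu$; right-hand sides may be $+\infty$. *)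

theory Defs
  imports "HOL-Probability.Probability"
begin

section \<open>Smooth functions and test functions\<close>

fun C_n :: "nat \<Rightarrow> ('a::real_normed_vector \<Rightarrow> 'b::real_normed_vector) \<Rightarrow> bool" where
  "C_n 0 f \<longleftrightarrow> continuous_on UNIV f"
| "C_n (Suc n) f \<longleftrightarrow> (\<forall>x. f differentiable (at x)) \<and>
     (\<forall>v. C_n n (\<lambda>x. frechet_derivative f (at x) v))"

definition smooth :: "('a::real_normed_vector \<Rightarrow> 'b::real_normed_vector) \<Rightarrow> bool" where
  "smooth f \<longleftrightarrow> (\<forall>n. C_n n f)"

definition test_function :: "(real^'n \<Rightarrow> real) \<Rightarrow> bool" where
  "test_function \<phi> \<longleftrightarrow> smooth \<phi> \<and> compact (closure {x. \<phi> x \<noteq> 0})"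

definition divergence :: "(real^'n \<Rightarrow> real^'n) \<Rightarrow> real^'n \<Rightarrow> real" where
  "divergence V x = (\<Sum>j\<in>UNIV. frechet_derivative V (at x) (axis j 1) $ j)"


section \<open>Distributional derivatives along vector fields\<close>

definition L1_loc :: "(real^'n \<Rightarrow> real) set" where
  "L1_loc = {h \<in> borel_measurable borel. \<forall>K. compact K \<longrightarrow> set_integrable lborel K h}"

definition Linf_loc :: "(real^'n \<Rightarrow> real) set" where
  "Linf_loc = {h \<in> borel_measurable borel.
     \<forall>K. compact K \<longrightarrow> (\<exists>B. AE x in lborel. x \<in> K \<longrightarrow> \<bar>h x\<bar> \<le> B)}"

text \<open>
  The formal adjoint of the first-order operator \<open>Y = (\<Sum>j. Y\<^sub>j \<partial>\<^sub>j)\<close> is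
  \<open>\<phi> \<mapsto> - div (\<phi> Y)\<close>; a locally integrable \<open>h\<close> is the distributional derivative
  \<open>Y f\<close> if pairing it with a test function agrees with pairing \<open>f\<close> with the adjoint.
  Such an \<open>h\<close> is determined only up to Lebesgue null sets, so the derivative is a relation
  between \<open>f\<close> and its Borel representatives.
\<close>

definition has_weak_deriv ::
  "(real^'n \<Rightarrow> real^'n) \<Rightarrow> (real^'n \<Rightarrow> real) \<Rightarrow> (real^'n \<Rightarrow> real) \<Rightarrow> bool" where
  "has_weak_deriv Y f h \<longleftrightarrow> h \<in> L1_loc \<and>
     (\<forall>\<phi>. test_function \<phi> \<longrightarrow>
        (LINT x|lborel. h x * \<phi> x) = - (LINT x|lborel. f x * divergence (\<lambda>y. \<phi> y *\<^sub>R Y y) x))"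

definition has_weak_gradient ::
  "('k::finite \<Rightarrow> real^'n \<Rightarrow> real^'n) \<Rightarrow> (real^'n \<Rightarrow> real) \<Rightarrow> (real^'n \<Rightarrow> real^'k) \<Rightarrow> bool" where
  "has_weak_gradient X f G \<longleftrightarrow> (\<forall>i. has_weak_deriv (X i) f (\<lambda>x. G x $ i))"

definition class_L :: "('k::finite \<Rightarrow> real^'n \<Rightarrow> real^'n) \<Rightarrow> (real^'n \<Rightarrow> real) set" where
  "class_L X = {f. continuous_on UNIV f \<and> (\<forall>i. \<exists>h\<in>Linf_loc. has_weak_deriv (X i) f h)}"


section \<open>The logarithmic Sobolev inequality\<close>

text \<open>
  Integral with values in the extended reals, meaningful when the positive or the negative part
  has finite integral (\<open>ennreal\<close> truncates negative reals to \<open>0\<close>). For the entropy integrand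
  below the negative part is bounded, so over a probability measure its integral
  lies in \<open>(-\<infinity>, \<infinity>]\<close>.
\<close>

definition ext_integral :: "'a measure \<Rightarrow> ('a \<Rightarrow> real) \<Rightarrow> ereal" where
  "ext_integral M h =
     enn2ereal (\<integral>\<^sup>+x. ennreal (h x) \<partial>M) - enn2ereal (\<integral>\<^sup>+x. ennreal (- h x) \<partial>M)"

text \<open>
  The convention \<open>0 log 0 = 0\<close> (also when \<open>g = 0\<close> almost everywhere) holds by \<open>ln 0 = 0\<close> and
  \<open>x / 0 = 0\<close>. As the measure is meant to be absolutely continuous with respect to Lebesgue
  measure, the right-hand side, which may be infinite, does not depend on the representative
  \<open>G\<close> of the gradient of \<open>g\<close>.
\<close>

definition LS ::
  "('k::finite \<Rightarrow> real^'n \<Rightarrow> real^'n) \<Rightarrow> (real^'n) measure \<Rightarrow> real \<Rightarrow> bool" where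
  "LS X \<mu> q \<longleftrightarrow> (\<exists>c::real. 0 < c \<and>
     (\<forall>g\<in>class_L X. \<forall>G. has_weak_gradient X g G \<longrightarrow>
        integrable \<mu> (\<lambda>x. \<bar>g x\<bar> powr q) \<longrightarrow>
        ext_integral \<mu> (\<lambda>x. \<bar>g x\<bar> powr q * ln (\<bar>g x\<bar> powr q / (LINT y|\<mu>. \<bar>g y\<bar> powr q)))
          \<le> ereal c * enn2ereal (\<integral>\<^sup>+x. ennreal (norm (G x) powr q) \<partial>\<mu>)))"

end

theory Submission
  imports Defs
begin

text \<open>
  Since \<open>a f + b\<close> dominates a nonnegative function, \<open>v = f + b / a\<close> is nonnegative and
  \<open>|\<nabla>v|\<^sup>q \<le> a v\<close>. The bounded functions \<open>w = n (1 - exp (- v / n))\<close> increase to \<open>v\<close> and satisfy the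
  same gradient bound, so by Fatou's lemma it suffices to bound their exponential moments uniformly
  in \<open>n\<close>. The logarithmic Sobolev inequality for \<open>w\<close> itself controls the mean of \<open>w\<close>: the entropy
  of \<open>w\<^sup>q\<close> is large where \<open>v\<close> is large, because that set has small measure. The inequality for
  \<open>exp (t w / q)\<close> then yields the exponential moment by Herbst's argument.

  The chain rule for these compositions only involves exponentials, hence follows from the product rule
  for continuous functions with weak derivatives along a smooth field \<open>Y\<close>. The product rule is
  obtained by doubling variables: each factor is tested in its own variable against a mollifier
  \<open>r(x - y)\<close>, and the error is a commutator of mollification with \<open>Y\<close> as in Friedrichs' lemma.
\<close>

section \<open>Smooth bump functions\<close>

text \<open>Neither \<open>f\<close> nor its exponentials are known to be integrable beforehand, so
  the entropy estimates are run on bounded functions and must end in constants free of the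
  truncation level \<open>n\<close>. Cutting off with \<open>min v n\<close> would call for a chain
  rule with a Lipschitz outer function; an exponential cutoff needs only power series, hence only
  products. The product rule is the analytic obstacle: derivatives exist only along the given
  fields, which may degenerate, and a test function times \<open>f\<close> or \<open>g\<close> is no
  longer a test function, so one weak equation cannot simply be inserted into the other. Herbst's
  argument only compares exponential moments with the mean, and no bound on the mean is assumed. The
  tail of the one finite function \<open>v\<close> supplies a level independent of \<open>n\<close>.
  The exponent enters through \<open>p = q - 1 > 0\<close>: at parameter \<open>t\<close> the
  entropy bound carries the relative factor \<open>t powr p\<close>, so the errors made at
  \<open>T\<close>, \<open>T / 2\<close>, \<open>T / 4\<close> and so on are summable.\<close>

lemma C_n_SucD: "C_n (Suc n) f \<Longrightarrow> C_n n f"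
proof (induction n arbitrary: f)
  case 0
  then show ?case
    by (auto intro!: continuous_at_imp_continuous_on differentiable_imp_continuous_within)
qed auto

lemma C_n_Suc:
  assumes "\<And>x. (f has_derivative f' x) (at x)" and "\<And>v. C_n n (\<lambda>x. f' x v)"
  shows "C_n (Suc n) f"
proof -
  have "frechet_derivative f (at x) = f' x" for x
    using assms(1) by (metis frechet_derivative_at)
  then show ?thesis using assms by (auto simp: differentiable_def)
qed

lemma C_n_differentiable: "C_n (Suc n) f \<Longrightarrow> (f has_derivative frechet_derivative f (at x)) (at x)"
  by (simp add: frechet_derivative_works)

lemma C_n_continuous: "C_n n f \<Longrightarrow> continuous_on A f"
  by (induction n) (auto dest: C_n_SucD intro: continuous_on_subset simp del: C_n.simps(2))

lemma C_n_const: "C_n n (\<lambda>x. c)"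
proof (induction n arbitrary: c)
  case (Suc n)
  then show ?case by (intro C_n_Suc[where f' = "\<lambda>x v. 0"]) auto
qed auto

lemma C_n_add: "C_n n f \<Longrightarrow> C_n n g \<Longrightarrow> C_n n (\<lambda>x. f x + g x)"
proof (induction n arbitrary: f g)
  case 0
  then show ?case by (auto intro: continuous_intros)
next
  case (Suc n)
  show ?case
  proof (rule C_n_Suc)
    show "((\<lambda>x. f x + g x) has_derivative
        (\<lambda>v. frechet_derivative f (at x) v + frechet_derivative g (at x) v)) (at x)" for x
      using Suc.prems by (intro derivative_intros C_n_differentiable)
    show "C_n n (\<lambda>x. frechet_derivative f (at x) v + frechet_derivative g (at x) v)" for v
      using Suc by auto
  qed
qed

lemma C_n_mult:
  fixes f g :: "'a::real_normed_vector \<Rightarrow> real"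
  shows "C_n n f \<Longrightarrow> C_n n g \<Longrightarrow> C_n n (\<lambda>x. f x * g x)"
proof (induction n arbitrary: f g)
  case 0
  then show ?case by (auto intro: continuous_intros)
next
  case (Suc n)
  show ?case
  proof (rule C_n_Suc)
    show "((\<lambda>x. f x * g x) has_derivative
        (\<lambda>v. f x * frechet_derivative g (at x) v + frechet_derivative f (at x) v * g x)) (at x)" for x
      using Suc.prems by (intro has_derivative_mult C_n_differentiable)
    show "C_n n (\<lambda>x. f x * frechet_derivative g (at x) v + frechet_derivative f (at x) v * g x)" for v
      using Suc.prems C_n_SucD[OF Suc.prems(1)] C_n_SucD[OF Suc.prems(2)]
      by (intro C_n_add Suc.IH) auto
  qed
qed

text \<open>\<open>frechet_derivative g (at s)\<close> is multiplication by its value at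
  \<open>1\<close>, a function of \<open>s\<close> one class lower. The induction therefore runs
  over all outer functions \<open>g\<close>.\<close>

lemma C_n_compose_real:
  fixes g :: "real \<Rightarrow> real" and p :: "'a::real_normed_vector \<Rightarrow> real"
  shows "C_n n g \<Longrightarrow> C_n n p \<Longrightarrow> C_n n (\<lambda>x. g (p x))"
proof (induction n arbitrary: g)
  case 0
  then show ?case using continuous_on_compose2[of UNIV g UNIV p] by auto
next
  case (Suc n)
  show ?case
  proof (rule C_n_Suc)
    show "((\<lambda>x. g (p x)) has_derivative
        (\<lambda>v. frechet_derivative g (at (p x)) 1 * frechet_derivative p (at x) v)) (at x)" for x
    proof -
      have g: "(g has_derivative frechet_derivative g (at (p x))) (at (p x))"
        using Suc.prems by (intro C_n_differentiable)
      have "frechet_derivative g (at (p x)) s = frechet_derivative g (at (p x)) 1 * s" for s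
        using linear_scale[OF has_derivative_linear[OF g], of s 1] by (simp add: mult.commute)
      then have eq: "(\<lambda>v. frechet_derivative g (at (p x)) (frechet_derivative p (at x) v))
          = (\<lambda>v. frechet_derivative g (at (p x)) 1 * frechet_derivative p (at x) v)"
        by (intro ext)
      have "(p has_derivative frechet_derivative p (at x)) (at x)"
        using Suc.prems by (intro C_n_differentiable)
      from has_derivative_compose[OF this g] show ?thesis
        unfolding eq .
    qed
    show "C_n n (\<lambda>x. frechet_derivative g (at (p x)) 1 * frechet_derivative p (at x) v)" for v
      using Suc.prems C_n_SucD[OF Suc.prems(2)]
      by (intro C_n_mult Suc.IH[of "\<lambda>s. frechet_derivative g (at s) 1"]) auto
  qed
qed

lemma smooth_mult:
  fixes f g :: "'a::real_normed_vector \<Rightarrow> real"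
  shows "smooth f \<Longrightarrow> smooth g \<Longrightarrow> smooth (\<lambda>x. f x * g x)"
  by (simp add: smooth_def C_n_mult)

lemma smooth_has_derivative: "smooth f \<Longrightarrow> (f has_derivative frechet_derivative f (at x)) (at x)"
  unfolding smooth_def by (metis C_n_differentiable)

lemma smooth_continuous: "smooth f \<Longrightarrow> continuous_on A f"
  unfolding smooth_def by (metis C_n_continuous)

lemma smooth_continuous_derivative:
  "smooth f \<Longrightarrow> continuous_on A (\<lambda>x. frechet_derivative f (at x) v)"
  unfolding smooth_def by (metis C_n.simps(2) C_n_continuous)

text \<open>For \<open>P = 1\<close> this is the classical exp(-1/t) extended by zero. A polynomial
  in 1/t is carried along because the family is then closed under differentiation, through
  \<open>flat_deriv\<close>.\<close>

definition flat :: "real poly \<Rightarrow> real \<Rightarrow> real" where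
  "flat P t = (if 0 < t then poly P (inverse t) * exp (- inverse t) else 0)"

definition flat_deriv :: "real poly \<Rightarrow> real poly" where
  "flat_deriv P = monom 1 2 * (P - pderiv P)"

lemma poly_exp_tendsto_0: "((\<lambda>x. poly P x * exp (- x)) \<longlongrightarrow> 0) (at_top :: real filter)"
proof -
  have "((\<lambda>x. coeff P i * (x ^ i / exp x)) \<longlongrightarrow> 0) (at_top :: real filter)" for i
    using tendsto_mult_right_zero[OF tendsto_power_div_exp_0] .
  then have "((\<lambda>x. \<Sum>i\<le>degree P. coeff P i * (x ^ i / exp x)) \<longlongrightarrow> 0) (at_top :: real filter)"
    by (intro tendsto_null_sum) auto
  moreover have "poly P x * exp (- x) = (\<Sum>i\<le>degree P. coeff P i * (x ^ i / exp x))" for x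
    by (simp add: poly_altdef sum_distrib_right sum_divide_distrib exp_minus field_simps)
  ultimately show ?thesis by presburger
qed

lemma flat_has_derivative: "(flat P has_real_derivative flat (flat_deriv P) t) (at t)"
proof -
  consider "t < 0" | "t = 0" | "0 < t" by linarith
  then show ?thesis
  proof cases
    case 1
    have "((\<lambda>x. 0) has_real_derivative 0) (at t)" by simp
    then have "(flat P has_real_derivative 0) (at t)"
      by (rule has_field_derivative_transform_within_open[of _ _ _ "{..<0}"])
         (use 1 in \<open>auto simp: flat_def\<close>)
    then show ?thesis using 1 by (simp add: flat_def)
  next
    case 2
    \<comment> \<open>Dividing by \<open>h\<close> raises the degree of the polynomial in 1/h by
      one, and the exponential decay still wins.\<close>
    have "((\<lambda>h. poly (monom 1 1 * P) (inverse h) * exp (- inverse h)) \<longlongrightarrow> 0) (at_right 0)"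
      by (rule filterlim_compose[OF poly_exp_tendsto_0 filterlim_inverse_at_top_right])
    then have "((\<lambda>h. flat P h / h) \<longlongrightarrow> 0) (at_right 0)"
      by (rule Lim_transform_eventually)
         (auto simp: eventually_at_right_field flat_def poly_monom field_simps intro!: exI[of _ 1])
    moreover have "((\<lambda>h. flat P h / h) \<longlongrightarrow> 0) (at_left 0)"
      by (rule Lim_transform_eventually[OF tendsto_const])
         (auto simp: eventually_at_left_field flat_def intro!: exI[of _ "-1"])
    ultimately have "((\<lambda>h. flat P h / h) \<longlongrightarrow> 0) (at 0)"
      by (simp add: filterlim_at_split)
    then show ?thesis using 2 by (simp add: has_field_derivative_iff flat_def)
  next
    case 3
    have "((\<lambda>x. poly P (inverse x) * exp (- inverse x)) has_real_derivative
        poly (flat_deriv P) (inverse t) * exp (- inverse t)) (at t)"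
      using 3 by (auto intro!: derivative_eq_intros
          simp: flat_deriv_def poly_monom power2_eq_square algebra_simps)
    then have "(flat P has_real_derivative poly (flat_deriv P) (inverse t) * exp (- inverse t)) (at t)"
      by (rule has_field_derivative_transform_within_open[of _ _ _ "{0<..}"])
         (use 3 in \<open>auto simp: flat_def\<close>)
    then show ?thesis using 3 by (simp add: flat_def)
  qed
qed

lemma C_n_flat: "C_n n (flat P)"
proof (induction n arbitrary: P)
  case 0
  show ?case
    using flat_has_derivative by (auto intro!: continuous_at_imp_continuous_on DERIV_isCont)
next
  case (Suc n)
  show ?case
  proof (rule C_n_Suc)
    show "(flat P has_derivative (*) (flat (flat_deriv P) x)) (at x)" for x
      using flat_has_derivative by (simp add: has_field_derivative_def)
    show "C_n n (\<lambda>x. flat (flat_deriv P) x * v)" for v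
      by (intro C_n_mult Suc C_n_const)
  qed
qed

definition bump :: "real \<Rightarrow> 'a::euclidean_space \<Rightarrow> 'a \<Rightarrow> real" where
  "bump e y x = flat 1 (e\<^sup>2 - (norm (x - y))\<^sup>2)"

text \<open>The gradient of the bump is \<open>- bump_slope e y x *\<^sub>R (x - y)\<close>:
  \<open>monom 1 2\<close> is \<open>flat_deriv 1\<close>, and the 2 comes from the squared norm.
  The radial form is what later pairs the slope with differences of a vector field.\<close>

definition bump_slope :: "real \<Rightarrow> 'a::euclidean_space \<Rightarrow> 'a \<Rightarrow> real" where
  "bump_slope e y x = 2 * flat (monom 1 2) (e\<^sup>2 - (norm (x - y))\<^sup>2)"

lemma bump_has_derivative:
  "(bump e y has_derivative (\<lambda>v. - bump_slope e y x * ((x - y) \<bullet> v))) (at x)"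
proof -
  have *: "((\<lambda>x. e\<^sup>2 - (norm (x - y))\<^sup>2) has_derivative (\<lambda>v. - 2 * ((x - y) \<bullet> v))) (at x)"
    unfolding power2_norm_eq_inner
    by (auto intro!: derivative_eq_intros simp: inner_commute algebra_simps)
  have "(flat 1 has_derivative (*) (flat (monom 1 2) s)) (at s)" for s
    using flat_has_derivative[of 1 s] by (simp add: has_field_derivative_def flat_deriv_def)
  from has_derivative_compose[OF * this] show ?thesis
    unfolding bump_def[abs_def] bump_slope_def by (simp add: mult_ac)
qed

lemma bump_smooth: "smooth (bump e y)"
proof -
  have "C_n n (\<lambda>x. x \<bullet> w)" for n and w :: 'a
  proof (cases n)
    case (Suc m)
    show ?thesis unfolding Suc
      by (rule C_n_Suc[where f' = "\<lambda>x v. v \<bullet> w"]) (auto intro!: derivative_eq_intros C_n_const)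
  qed (auto intro!: continuous_intros)
  note lin = this
  have "C_n n (\<lambda>x. e\<^sup>2 - (norm (x - y))\<^sup>2)" for n
  proof (cases n)
    case (Suc m)
    show ?thesis unfolding Suc
    proof (rule C_n_Suc)
      show "((\<lambda>x. e\<^sup>2 - (norm (x - y))\<^sup>2) has_derivative (\<lambda>v. x \<bullet> (- 2 *\<^sub>R v) + 2 * (y \<bullet> v))) (at x)" for x
        unfolding power2_norm_eq_inner
        by (auto intro!: derivative_eq_intros simp: inner_commute algebra_simps)
      show "C_n m (\<lambda>x. x \<bullet> (- 2 *\<^sub>R v) + 2 * (y \<bullet> v))" for v
        by (intro C_n_add lin C_n_const)
    qed
  qed (auto intro!: continuous_intros)
  then show ?thesis
    unfolding smooth_def bump_def[abs_def]
    using C_n_compose_real[OF C_n_flat[of _ 1], of _ "\<lambda>x. e\<^sup>2 - (norm (x - y))\<^sup>2"] by blast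
qed

lemma flat_continuous: "continuous_on A (flat P)"
  using C_n_flat C_n_continuous by blast

lemma bump_continuous: "continuous_on A (\<lambda>z. bump e (snd z) (fst z))"
  unfolding bump_def
  by (rule continuous_on_compose2[OF flat_continuous[of UNIV]]) (auto intro!: continuous_intros)

lemma bump_slope_continuous: "continuous_on A (\<lambda>z. bump_slope e (snd z) (fst z))"
  unfolding bump_slope_def
  by (intro continuous_intros continuous_on_compose2[OF flat_continuous[of UNIV]]) auto

lemma bump_sym: "bump e y x = bump e x y" and bump_slope_sym: "bump_slope e y x = bump_slope e x y"
  by (simp_all add: bump_def bump_slope_def norm_minus_commute)

lemma bump_nonneg: "0 \<le> bump e y x" and bump_slope_nonneg: "0 \<le> bump_slope e y x"
  by (simp_all add: bump_def bump_slope_def flat_def poly_monom)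

lemma bump_eq_0: "0 \<le> e \<Longrightarrow> e \<le> dist x y \<Longrightarrow> bump e y x = 0"
  and bump_slope_eq_0: "0 \<le> e \<Longrightarrow> e \<le> dist x y \<Longrightarrow> bump_slope e y x = 0"
  by (simp_all add: bump_def bump_slope_def flat_def dist_norm leD power_mono)

lemma bump_pos: "dist x y < e \<Longrightarrow> 0 < bump e y x"
  by (simp add: bump_def flat_def dist_norm power_strict_mono)

section \<open>Test functions and their supports\<close>

lemma test_functionI:
  assumes "smooth \<phi>" "compact K" "\<And>x. x \<notin> K \<Longrightarrow> \<phi> x = 0"
  shows "test_function \<phi>"
proof -
  have "{x. \<phi> x \<noteq> 0} \<subseteq> K" using assms by auto
  then show ?thesis
    using assms unfolding test_function_def
    by (metis bounded_subset compact_closure compact_imp_bounded)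
qed

lemma test_function_mult:
  assumes "test_function \<phi>" "smooth \<psi>"
  shows "test_function (\<lambda>x. \<psi> x * \<phi> x)"
proof (rule test_functionI[of _ "closure {x. \<phi> x \<noteq> 0}"])
  show "\<psi> x * \<phi> x = 0" if "x \<notin> closure {x. \<phi> x \<noteq> 0}" for x
    using that closure_subset[of "{x. \<phi> x \<noteq> 0}"] by auto
qed (use assms in \<open>auto simp: test_function_def intro: smooth_mult\<close>)

lemma test_function_support:
  assumes "test_function \<phi>"
  obtains R where "0 < R" "\<And>x. R < norm x \<Longrightarrow> \<phi> x = 0"
proof -
  have "bounded (closure {x. \<phi> x \<noteq> 0})"
    using assms unfolding test_function_def by (simp add: compact_imp_bounded)
  then obtain R where "0 < R" "\<forall>x\<in>closure {x. \<phi> x \<noteq> 0}. norm x \<le> R"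
    by (auto simp: bounded_pos)
  then show ?thesis
    using that closure_subset[of "{x. \<phi> x \<noteq> 0}"] by (metis (mono_tags, lifting) mem_Collect_eq not_le subsetD)
qed

section \<open>The divergence theorem for compactly supported fields\<close>

lemma integrable_compact_support:
  fixes u :: "'a::euclidean_space \<Rightarrow> real"
  assumes "continuous_on UNIV u" "\<And>x. R < norm x \<Longrightarrow> u x = 0"
  shows "integrable lborel u"
proof -
  have "integrable lborel (\<lambda>x. indicator (cball 0 R) x *\<^sub>R u x)"
    using assms by (intro borel_integrable_compact) (auto intro: continuous_on_subset)
  moreover have "(\<lambda>x. indicator (cball 0 R) x *\<^sub>R u x) = u"
    using assms(2) by (auto simp: indicator_def fun_eq_iff not_le)
  ultimately show ?thesis by simp
qed

lemma compact_support_bounded: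
  fixes u :: "'a::euclidean_space \<Rightarrow> real"
  assumes "continuous_on UNIV u" "\<And>x. R < norm x \<Longrightarrow> u x = 0"
  obtains C where "0 < C" "\<And>x. \<bar>u x\<bar> \<le> C"
proof -
  have "bounded (u ` cball 0 R)"
    using assms by (intro compact_imp_bounded compact_continuous_image) (auto intro: continuous_on_subset)
  then obtain C where C: "0 < C" "\<forall>y\<in>u ` cball 0 R. norm y \<le> C" by (auto simp: bounded_pos)
  have "\<bar>u x\<bar> \<le> C" for x
    using C assms(2)[of x] by (cases "R < norm x") auto
  with C show ?thesis using that by blast
qed

lemma frechet_derivative_outside_support:
  fixes u :: "'a::real_normed_vector \<Rightarrow> 'b::real_normed_vector"
  assumes "\<And>x. R < norm x \<Longrightarrow> u x = 0" "R < norm x"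
  shows "frechet_derivative u (at x) = (\<lambda>v. 0)"
proof -
  have "open {x::'a. R < norm x}" by (intro open_Collect_less continuous_intros)
  then have "(u has_derivative (\<lambda>v. 0)) (at x)"
    using assms by (intro has_derivative_transform_within_open[OF has_derivative_const[of 0]]) auto
  then show ?thesis using frechet_derivative_at by metis
qed

text \<open>Translation invariance: the difference quotients of \<open>u\<close> have integral zero.\<close>

lemma integral_directional_derivative_eq_0:
  fixes u :: "'a::euclidean_space \<Rightarrow> real"
  assumes u: "\<And>x. u differentiable (at x)"
    and cont: "continuous_on UNIV (\<lambda>x. frechet_derivative u (at x) v)"
    and supp: "\<And>x. R < norm x \<Longrightarrow> u x = 0"
  shows "(LINT x|lborel. frechet_derivative u (at x) v) = 0"
proof -
  let ?D = "\<lambda>x. frechet_derivative u (at x) v"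
  have cu: "continuous_on UNIV u"
    using u by (auto intro!: continuous_at_imp_continuous_on differentiable_imp_continuous_within)
  obtain C where C: "0 < C" "\<And>x. \<bar>?D x\<bar> \<le> C"
    using compact_support_bounded[OF cont, of R] by (auto simp: frechet_derivative_outside_support[OF supp])
  note D = frechet_derivative_works[THEN iffD1, OF u]
  have iu: "integrable lborel u" using integrable_compact_support[OF cu supp] .
  define s where "s m = (\<lambda>x. (u (x + inverse (real (Suc m)) *\<^sub>R v) - u x) * real (Suc m))" for m
  have line: "((\<lambda>t. u (x + t *\<^sub>R v)) has_real_derivative ?D (x + t *\<^sub>R v)) (at t)" for x t
  proof -
    have "((\<lambda>t. x + t *\<^sub>R v) has_derivative (\<lambda>t. t *\<^sub>R v)) (at t)"
      by (auto intro!: derivative_eq_intros)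
    from has_derivative_compose[OF this D]
    have "((\<lambda>t. u (x + t *\<^sub>R v)) has_derivative (\<lambda>s. frechet_derivative u (at (x + t *\<^sub>R v)) (s *\<^sub>R v))) (at t)" .
    moreover have "frechet_derivative u (at y) (s *\<^sub>R v) = ?D y * s" for s y
      using linear_scale[OF has_derivative_linear[OF D], of y s v] by simp
    ultimately show ?thesis by (simp add: has_field_derivative_def)
  qed
  have lim: "(\<lambda>m. s m x) \<longlonglongrightarrow> ?D x" for x
  proof -
    have "((\<lambda>h. (u (x + h *\<^sub>R v) - u x) / h) \<longlongrightarrow> ?D x) (at 0)"
      using line[of x 0] by (simp add: has_field_derivative_iff)
    moreover have "filterlim (\<lambda>m. inverse (real (Suc m))) (at 0) sequentially"
      using LIMSEQ_inverse_real_of_nat by (simp add: filterlim_at)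
    ultimately have "(\<lambda>m. (u (x + inverse (real (Suc m)) *\<^sub>R v) - u x) / inverse (real (Suc m))) \<longlonglongrightarrow> ?D x"
      by (rule filterlim_compose)
    then show ?thesis by (simp add: s_def divide_inverse)
  qed
  \<comment> \<open>By the mean value theorem a difference quotient is a derivative at an
    intermediate point, and steps of length at most 1 enlarge the support by at most
    \<open>norm v\<close>. This gives the integrable majorant.\<close>
  have bound: "\<bar>s m x\<bar> \<le> C * indicator (cball 0 (R + norm v)) x" for m x
  proof -
    let ?h = "inverse (real (Suc m))"
    have h: "0 < ?h" "?h \<le> 1" by (auto simp: inverse_le_1_iff)
    obtain z where "u (x + ?h *\<^sub>R v) - u (x + 0 *\<^sub>R v) = (?h - 0) * ?D (x + z *\<^sub>R v)"
      using MVT2[OF h(1), of "\<lambda>t. u (x + t *\<^sub>R v)" "\<lambda>t. ?D (x + t *\<^sub>R v)"] line by blast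
    then have "s m x = ?D (x + z *\<^sub>R v)" by (simp add: s_def)
    then have 1: "\<bar>s m x\<bar> \<le> C" using C by simp
    have "s m x = 0" if "R + norm v < norm x"
    proof -
      have "norm (?h *\<^sub>R v) \<le> norm v" using h by (simp add: mult_left_le_one_le)
      moreover have "norm x \<le> norm (x + ?h *\<^sub>R v) + norm (?h *\<^sub>R v)"
        using norm_triangle_ineq4[of "x + ?h *\<^sub>R v" "?h *\<^sub>R v"] by simp
      ultimately have "R < norm (x + ?h *\<^sub>R v)" "R < norm x" using that norm_ge_zero[of v] by linarith+
      then show ?thesis by (simp add: s_def supp)
    qed
    with 1 show ?thesis by (auto simp: indicator_def)
  qed
  have "(LINT x|lborel. s m x) = 0" for m
  proof -
    let ?w = "inverse (real (Suc m)) *\<^sub>R v"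
    have b: "u \<in> borel_measurable borel" using cu by (rule borel_measurable_continuous_onI)
    have "(LINT x|lborel. u (?w + x)) = integral\<^sup>L (distr lborel borel ((+) ?w)) u"
      using b by (subst integral_distr) auto
    then have e: "(LINT x|lborel. u (x + ?w)) = (LINT x|lborel. u x)"
      by (simp add: lborel_distr_plus add.commute)
    have "integrable (distr lborel borel ((+) ?w)) u" using iu by (simp add: lborel_distr_plus)
    then have "integrable lborel (\<lambda>x. u (x + ?w))"
      using b by (subst (asm) integrable_distr_eq) (auto simp: add.commute)
    then show ?thesis using e iu unfolding s_def by simp
  qed
  moreover have "(\<lambda>m. LINT x|lborel. s m x) \<longlonglongrightarrow> (LINT x|lborel. ?D x)"
  proof (rule integral_dominated_convergence)
    show "integrable lborel (\<lambda>x::'a. C * indicator (cball 0 (R + norm v)) x)"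
      using emeasure_compact_finite[OF compact_cball[of "0::'a" "R + norm v"]]
      by (intro integrable_mult_right) (auto simp: integrable_indicator_iff)
    have "u \<in> borel_measurable borel" using cu by (rule borel_measurable_continuous_onI)
    then show "s m \<in> borel_measurable lborel" for m
      unfolding s_def by measurable
    show "(\<lambda>x. ?D x) \<in> borel_measurable lborel"
      using borel_measurable_continuous_onI[OF cont] by simp
  qed (use lim bound in auto)
  ultimately show ?thesis by (simp add: LIMSEQ_const_iff)
qed

section \<open>The divergence of a vector field and its integral\<close>

lemma divergence_has_derivative:
  assumes "(V has_derivative V') (at x)"
  shows "divergence V x = (\<Sum>j\<in>UNIV. V' (axis j 1) $ j)"
  unfolding divergence_def using frechet_derivative_at[OF assms] by simp

lemma divergence_scaleR:
  fixes V :: "real^'n \<Rightarrow> real^'n"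
  assumes "(\<phi> has_derivative \<phi>') (at x)" and V: "V differentiable (at x)"
  shows "divergence (\<lambda>y. \<phi> y *\<^sub>R V y) x = \<phi> x * divergence V x + \<phi>' (V x)"
proof -
  let ?V = "frechet_derivative V (at x)"
  have "((\<lambda>y. \<phi> y *\<^sub>R V y) has_derivative (\<lambda>v. \<phi> x *\<^sub>R ?V v + \<phi>' v *\<^sub>R V x)) (at x)"
    using assms frechet_derivative_works[THEN iffD1, OF V] by (intro has_derivative_scaleR) auto
  from divergence_has_derivative[OF this]
  have "divergence (\<lambda>y. \<phi> y *\<^sub>R V y) x
      = \<phi> x * divergence V x + (\<Sum>j\<in>UNIV. V x $ j * \<phi>' (axis j 1))"
    by (simp add: divergence_def[of V] sum.distrib sum_distrib_left mult.commute)
  also have "(\<Sum>j\<in>UNIV. V x $ j * \<phi>' (axis j 1)) = \<phi>' (\<Sum>j\<in>UNIV. V x $ j *\<^sub>R axis j 1)"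
    using has_derivative_linear[OF assms(1)] by (simp add: linear_sum linear_scale)
  also have "(\<Sum>j\<in>UNIV. V x $ j *\<^sub>R axis j 1) = V x"
    by (metis basis_expansion scalar_mult_eq_scaleR)
  finally show ?thesis .
qed

lemma integral_divergence_eq_0:
  fixes V :: "real^'n \<Rightarrow> real^'n"
  assumes V: "\<And>x. V differentiable (at x)"
    and cont: "\<And>v. continuous_on UNIV (\<lambda>x. frechet_derivative V (at x) v)"
    and supp: "\<And>x. R < norm x \<Longrightarrow> V x = 0"
  shows "(LINT x|lborel. divergence V x) = 0"
proof -
  have D: "((\<lambda>x. V x $ j) has_derivative (\<lambda>v. frechet_derivative V (at x) v $ j)) (at x)" for x j
    by (rule bounded_linear.has_derivative[OF bounded_linear_vec_nth frechet_derivative_works[THEN iffD1, OF V]])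
  then have eq: "frechet_derivative V (at x) v $ j = frechet_derivative (\<lambda>x. V x $ j) (at x) v" for x j v
    by (metis frechet_derivative_at)
  have c: "continuous_on UNIV (\<lambda>x. frechet_derivative V (at x) v $ j)" for v j
    by (intro continuous_intros cont)
  have "(LINT x|lborel. divergence V x) = (\<Sum>j\<in>UNIV. LINT x|lborel. frechet_derivative V (at x) (axis j 1) $ j)"
    unfolding divergence_def
  proof (rule Bochner_Integration.integral_sum)
    show "integrable lborel (\<lambda>x. frechet_derivative V (at x) (axis j 1) $ j)" for j
      by (rule integrable_compact_support[OF c, of R])
         (simp add: frechet_derivative_outside_support[OF supp])
  qed
  also have "\<dots> = 0"
    unfolding eq
  proof (intro sum.neutral ballI integral_directional_derivative_eq_0[where R = R])
    show "continuous_on UNIV (\<lambda>x. frechet_derivative (\<lambda>x. V x $ j) (at x) (axis j 1))" for j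
      using c[of "axis j 1" j] by (simp add: eq)
  qed (use D supp in \<open>auto simp: differentiable_def\<close>)
  finally show ?thesis .
qed

section \<open>Mollifiers\<close>

lemma lborel_integral_translate:
  fixes u :: "'a::euclidean_space \<Rightarrow> real"
  assumes "u \<in> borel_measurable borel"
  shows "(LINT x|lborel. u (x - w)) = (LINT x|lborel. u x)"
proof -
  have "(LINT x|lborel. u (- w + x)) = integral\<^sup>L (distr lborel borel ((+) (- w))) u"
    using assms by (subst integral_distr) auto
  then show ?thesis by (simp add: lborel_distr_plus)
qed

text \<open>The mass depends on the dimension, which \<open>e\<close> does not reveal; the
  \<open>itself\<close> argument fixes the space.\<close>

definition bump_mass :: "'a::euclidean_space itself \<Rightarrow> real \<Rightarrow> real" where
  "bump_mass T e = (LINT x|lborel. bump e (0::'a) x)"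

lemma bump_continuous_snd: "continuous_on A (bump e y)"
  using bump_smooth smooth_continuous by blast

lemma bump_support: "0 \<le> e \<Longrightarrow> norm y + e < norm x \<Longrightarrow> bump e y x = 0"
  using norm_triangle_ineq2[of x y] by (intro bump_eq_0) (auto simp: dist_norm)

lemma integrable_bump: "0 \<le> e \<Longrightarrow> integrable lborel (bump e y)"
  by (rule integrable_compact_support[OF bump_continuous_snd bump_support])

lemma bump_mass_pos:
  assumes "0 < e" shows "0 < bump_mass TYPE('a::euclidean_space) e"
proof -
  have "0 \<le> bump_mass TYPE('a) e"
    unfolding bump_mass_def by (simp add: bump_nonneg)
  moreover have "bump_mass TYPE('a) e \<noteq> 0"
  proof
    assume "bump_mass TYPE('a) e = 0"
    then have "AE x in lborel. bump e (0::'a) x = 0"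
      unfolding bump_mass_def using assms
      by (subst (asm) integral_nonneg_eq_0_iff_AE) (auto simp: integrable_bump bump_nonneg)
    moreover have "bump e (0::'a) x \<noteq> 0" if "x \<in> ball 0 e" for x
      using that bump_pos[of x 0 e] by (simp add: dist_commute)
    ultimately have "AE x in lborel. x \<notin> ball (0::'a) e"
      by (elim eventually_mono) blast
    then have "ball (0::'a) e \<in> null_sets lborel"
      by (simp add: AE_iff_null_sets)
    then have "negligible (ball (0::'a) e)"
      by (simp add: negligible_iff_null_sets null_sets_completionI)
    then show False using assms open_not_negligible[of "ball (0::'a) e"] by simp
  qed
  ultimately show ?thesis by simp
qed

definition moll :: "real \<Rightarrow> 'a::euclidean_space \<Rightarrow> 'a \<Rightarrow> real" where
  "moll e y x = bump e y x / bump_mass TYPE('a) e"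

definition moll_slope :: "real \<Rightarrow> 'a::euclidean_space \<Rightarrow> 'a \<Rightarrow> real" where
  "moll_slope e y x = bump_slope e y x / bump_mass TYPE('a) e"

lemma moll_has_derivative:
  "(moll e y has_derivative (\<lambda>v. - moll_slope e y x * ((x - y) \<bullet> v))) (at x)"
proof -
  have "((\<lambda>x. inverse (bump_mass TYPE('a) e) * bump e y x) has_derivative
      (\<lambda>v. inverse (bump_mass TYPE('a) e) * (- bump_slope e y x * ((x - y) \<bullet> v)))) (at x)"
    by (intro derivative_intros bump_has_derivative)
  then show ?thesis by (simp add: moll_def[abs_def] moll_slope_def divide_inverse mult_ac)
qed

lemma moll_smooth: "smooth (moll e y)"
  using smooth_mult[OF bump_smooth, of "\<lambda>x. inverse (bump_mass TYPE('a) e)" e y]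
  by (simp add: moll_def[abs_def] divide_inverse smooth_def C_n_const)

lemma moll_sym: "moll e y x = moll e x y" and moll_slope_sym: "moll_slope e y x = moll_slope e x y"
  unfolding moll_def moll_slope_def by (simp_all add: bump_sym[of e x y] bump_slope_sym[of e x y])

lemma moll_continuous: "continuous_on A (\<lambda>z. moll e (snd z) (fst z))"
  and moll_slope_continuous: "continuous_on A (\<lambda>z. moll_slope e (snd z) (fst z))"
  unfolding moll_def moll_slope_def divide_inverse
  by (intro continuous_intros bump_continuous bump_slope_continuous)+

lemma moll_nonneg: "0 < e \<Longrightarrow> 0 \<le> moll e y x"
  and moll_slope_nonneg: "0 < e \<Longrightarrow> 0 \<le> moll_slope e y x"
  unfolding moll_def moll_slope_def
  using bump_mass_pos[of e] by (auto simp: bump_nonneg bump_slope_nonneg intro!: divide_nonneg_pos)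

lemma moll_eq_0: "0 < e \<Longrightarrow> e \<le> dist x y \<Longrightarrow> moll e y x = 0"
  and moll_slope_eq_0: "0 < e \<Longrightarrow> e \<le> dist x y \<Longrightarrow> moll_slope e y x = 0"
  by (simp_all add: moll_def moll_slope_def bump_eq_0 bump_slope_eq_0)

lemma moll_support: "0 < e \<Longrightarrow> norm y + e < norm x \<Longrightarrow> moll e y x = 0"
  and moll_slope_support: "0 < e \<Longrightarrow> norm y + e < norm x \<Longrightarrow> moll_slope e y x = 0"
  using norm_triangle_ineq2[of x y] by (auto intro!: moll_eq_0 moll_slope_eq_0 simp: dist_norm)

lemma test_function_moll: "0 < e \<Longrightarrow> test_function (moll e y)"
  by (rule test_functionI[OF moll_smooth compact_cball[of y e]])
     (auto intro!: moll_eq_0 simp: dist_commute)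

lemma integrable_moll: "0 < e \<Longrightarrow> integrable lborel (moll e y)"
  by (simp add: moll_def[abs_def] integrable_bump)

lemma integral_moll: "0 < e \<Longrightarrow> (LINT x|lborel. moll e y x) = 1"
proof -
  assume e: "0 < e"
  have "(LINT x|lborel. bump e y x) = (LINT x|lborel. bump e 0 (x - y))"
    by (simp add: bump_def)
  also have "\<dots> = bump_mass TYPE('a) e"
    unfolding bump_mass_def
    by (rule lborel_integral_translate) (intro borel_measurable_continuous_onI bump_continuous_snd)
  finally show ?thesis using bump_mass_pos[OF e, where 'a='a] by (simp add: moll_def[abs_def])
qed

lemma moll_slope_continuous_snd: "continuous_on A (moll_slope e y)"
proof -
  have "continuous_on A (\<lambda>x. moll_slope e (snd (x, y)) (fst (x, y)))"
    by (rule continuous_on_compose2[OF moll_slope_continuous[of UNIV]]) (auto intro!: continuous_intros)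
  then show ?thesis by simp
qed

text \<open>Integrating the divergence of \<open>x \<mapsto> moll e y x *\<^sub>R (x - y)\<close> gives the second moment of the slope
  exactly, whatever the scale \<open>e\<close>.\<close>

lemma
  fixes y :: "real^'n"
  assumes e: "0 < e"
  shows integrable_moll_slope: "integrable lborel (\<lambda>x. moll_slope e y x * (norm (x - y))\<^sup>2)"
    and integral_moll_slope: "(LINT x|lborel. moll_slope e y x * (norm (x - y))\<^sup>2) = CARD('n)"
proof -
  let ?V = "\<lambda>x. moll e y x *\<^sub>R (x - y)"
  let ?V' = "\<lambda>x v. moll e y x *\<^sub>R v + (- moll_slope e y x * ((x - y) \<bullet> v)) *\<^sub>R (x - y)"
  show int: "integrable lborel (\<lambda>x. moll_slope e y x * (norm (x - y))\<^sup>2)"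
    by (rule integrable_compact_support[of _ "norm y + e"])
       (auto intro!: continuous_intros moll_slope_continuous_snd simp: moll_slope_support e)
  have D: "(?V has_derivative ?V' x) (at x)" for x
    by (auto intro!: derivative_eq_intros moll_has_derivative)
  have eq: "frechet_derivative ?V (at x) = ?V' x" for x
    using frechet_derivative_at[OF D] by simp
  have id: "((\<lambda>x. x - y) has_derivative (\<lambda>v. v)) (at x)" for x
    by (auto intro!: derivative_eq_intros)
  have "divergence (\<lambda>x. x - y) x = CARD('n)" "(\<lambda>x. x - y) differentiable (at x)" for x
    using divergence_has_derivative[OF id] id by (auto simp: differentiable_def)
  then have "divergence ?V x = moll e y x * CARD('n) - moll_slope e y x * (norm (x - y))\<^sup>2" for x
    by (simp add: divergence_scaleR[OF moll_has_derivative] power2_norm_eq_inner)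
  moreover have "(LINT x|lborel. divergence ?V x) = 0"
  proof (rule integral_divergence_eq_0)
    show "continuous_on UNIV (\<lambda>x. frechet_derivative ?V (at x) v)" for v
      unfolding eq
      by (intro continuous_intros moll_slope_continuous_snd smooth_continuous moll_smooth)
    show "?V x = 0" if "norm y + e < norm x" for x
      using moll_support[OF e that] by simp
  qed (use D in \<open>auto simp: differentiable_def\<close>)
  ultimately show "(LINT x|lborel. moll_slope e y x * (norm (x - y))\<^sup>2) = CARD('n)"
    using int integrable_moll[OF e, of y] by (simp add: integral_moll[OF e])
qed

text \<open>Serves all double integrals of the product rule: the two weights have an integrable
  product, and a continuous kernel, however large, is bounded on the compact product of their
  supports.\<close>

lemma integrable_kernel:
  fixes \<alpha> \<beta> :: "'a::euclidean_space \<Rightarrow> real" and \<kappa> :: "'a \<Rightarrow> 'a \<Rightarrow> real"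
  assumes \<alpha>: "integrable lborel \<alpha>" "\<And>x. A < norm x \<Longrightarrow> \<alpha> x = 0"
    and \<beta>: "integrable lborel \<beta>" "\<And>y. B < norm y \<Longrightarrow> \<beta> y = 0"
    and \<kappa>: "continuous_on UNIV (\<lambda>z. \<kappa> (fst z) (snd z))"
  shows "integrable (lborel \<Otimes>\<^sub>M lborel) (\<lambda>(x, y). \<alpha> x * \<beta> y * \<kappa> x y)"
proof -
  have [measurable]: "\<alpha> \<in> borel_measurable borel" "\<beta> \<in> borel_measurable borel"
    using \<alpha>(1) \<beta>(1) by auto
  have "(\<lambda>z. \<kappa> (fst z) (snd z)) \<in> borel_measurable borel"
    using \<kappa> by (rule borel_measurable_continuous_onI)
  then have [measurable]: "(\<lambda>z. \<kappa> (fst z) (snd z)) \<in> borel_measurable (borel \<Otimes>\<^sub>M borel)"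
    by (simp add: borel_prod)
  have "bounded ((\<lambda>z. \<kappa> (fst z) (snd z)) ` (cball 0 A \<times> cball 0 B))"
    using \<kappa> by (intro compact_imp_bounded compact_continuous_image compact_Times)
      (auto intro: continuous_on_subset)
  then obtain C where C: "\<And>x y. norm x \<le> A \<Longrightarrow> norm y \<le> B \<Longrightarrow> \<bar>\<kappa> x y\<bar> \<le> C"
    by (force simp: bounded_iff)
  have 1: "integrable (lborel \<Otimes>\<^sub>M lborel) (\<lambda>(x, y). \<alpha> x * \<beta> y)"
    using \<alpha>(1) \<beta>(1)
    by (intro lborel_pair.Fubini_integrable) (auto simp: abs_mult)
  show ?thesis
  proof (rule Bochner_Integration.integrable_bound)
    show "integrable (lborel \<Otimes>\<^sub>M lborel) (\<lambda>z. C * (case z of (x, y) \<Rightarrow> \<alpha> x * \<beta> y))"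
      using 1 by (rule integrable_mult_right)
    show "(\<lambda>(x, y). \<alpha> x * \<beta> y * \<kappa> x y) \<in> borel_measurable (lborel \<Otimes>\<^sub>M lborel)"
      unfolding case_prod_beta by measurable
    have "\<bar>\<alpha> x * \<beta> y * \<kappa> x y\<bar> \<le> \<bar>C * (\<alpha> x * \<beta> y)\<bar>" for x y
    proof (cases "norm x \<le> A \<and> norm y \<le> B")
      case True
      then have "\<bar>\<alpha> x * \<beta> y\<bar> * \<bar>\<kappa> x y\<bar> \<le> \<bar>\<alpha> x * \<beta> y\<bar> * \<bar>C\<bar>"
        using C[of x y] by (intro mult_left_mono) auto
      then show ?thesis by (simp add: abs_mult mult_ac)
    next
      case False
      then show ?thesis using \<alpha>(2) \<beta>(2) by (auto simp: not_le)
    qed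
    then show "AE z in lborel \<Otimes>\<^sub>M lborel. norm (case z of (x, y) \<Rightarrow> \<alpha> x * \<beta> y * \<kappa> x y)
        \<le> norm (C * (case z of (x, y) \<Rightarrow> \<alpha> x * \<beta> y))"
      by (auto simp: case_prod_beta)
  qed
qed

text \<open>The mollifier is a probability density supported within distance \<open>e\<close> of
  \<open>x\<close>, so averaging against it preserves any bound on \<open>\<beta> - b\<close> over
  that ball.\<close>

lemma moll_average:
  fixes \<beta> :: "'a::euclidean_space \<Rightarrow> real"
  assumes e: "0 < e" and int: "integrable lborel (\<lambda>y. \<beta> y * moll e x y)"
    and w: "\<And>y. dist y x < e \<Longrightarrow> \<bar>\<beta> y - b\<bar> \<le> w"
  shows "\<bar>(LINT y|lborel. \<beta> y * moll e x y) - b\<bar> \<le> w"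
proof -
  note m = integrable_moll[OF e, of x] integral_moll[OF e, of x]
  have "(LINT y|lborel. \<beta> y * moll e x y) - b = (LINT y|lborel. (\<beta> y - b) * moll e x y)"
    using int m by (simp add: left_diff_distrib)
  also have "\<bar>\<dots>\<bar> \<le> (LINT y|lborel. w * moll e x y)"
  proof (rule integral_abs_bound_integral)
    show "integrable lborel (\<lambda>y. (\<beta> y - b) * moll e x y)"
      using int m by (simp add: left_diff_distrib)
    show "\<bar>(\<beta> y - b) * moll e x y\<bar> \<le> w * moll e x y" for y
      using w[of y] moll_nonneg[OF e, of x y] moll_eq_0[OF e, of y x]
      by (cases "dist y x < e") (auto simp: abs_mult mult_right_mono)
  qed (use m in auto)
  finally show ?thesis using m by simp
qed

section \<open>Local integrability and local bounds for smooth fields\<close>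

lemma L1_loc_mult_continuous:
  fixes h u :: "real^'n \<Rightarrow> real"
  assumes h: "h \<in> L1_loc" and u: "continuous_on UNIV u"
  shows "(\<lambda>x. h x * u x) \<in> L1_loc"
  unfolding L1_loc_def
proof (intro CollectI conjI allI impI)
  have [measurable]: "h \<in> borel_measurable borel" "u \<in> borel_measurable borel"
    using h u by (auto simp: L1_loc_def borel_measurable_continuous_onI)
  show "(\<lambda>x. h x * u x) \<in> borel_measurable borel" by measurable
  fix K :: "(real^'n) set" assume K: "compact K"
  have [measurable]: "K \<in> sets borel" using K by (simp add: borel_compact)
  have "bounded (u ` K)"
    using K u by (intro compact_imp_bounded compact_continuous_image) (auto intro: continuous_on_subset)
  then obtain C where C: "\<And>x. x \<in> K \<Longrightarrow> \<bar>u x\<bar> \<le> C" by (force simp: bounded_iff)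
  have "integrable lborel (\<lambda>x. C * (indicator K x *\<^sub>R h x))"
    using h K by (intro integrable_mult_right) (auto simp: L1_loc_def set_integrable_def)
  then show "set_integrable lborel K (\<lambda>x. h x * u x)"
    unfolding set_integrable_def
  proof (rule Bochner_Integration.integrable_bound)
    have "\<bar>h x * u x\<bar> \<le> \<bar>C * h x\<bar>" if "x \<in> K" for x
    proof -
      have "\<bar>h x\<bar> * \<bar>u x\<bar> \<le> \<bar>h x\<bar> * \<bar>C\<bar>" using C[OF that] by (intro mult_left_mono) auto
      then show ?thesis by (simp add: abs_mult mult.commute)
    qed
    then show "AE x in lborel. norm (indicator K x *\<^sub>R (h x * u x)) \<le> norm (C * (indicator K x *\<^sub>R h x))"
      by (auto simp: indicator_def)
  qed measurable
qed

lemma L1_loc_integrable: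
  assumes h: "h \<in> L1_loc" and "\<And>x. R < norm x \<Longrightarrow> h x = 0"
  shows "integrable lborel h"
proof -
  have "integrable lborel (\<lambda>x. indicator (cball 0 R) x *\<^sub>R h x)"
    using h by (simp add: L1_loc_def set_integrable_def)
  moreover have "(\<lambda>x. indicator (cball 0 R) x *\<^sub>R h x) = h"
    using assms(2) by (auto simp: indicator_def fun_eq_iff not_le)
  ultimately show ?thesis by simp
qed

lemma continuous_frechet_scaleR:
  fixes \<psi> :: "real^'n \<Rightarrow> real" and Y :: "real^'n \<Rightarrow> real^'n"
  assumes "smooth \<psi>" "smooth Y"
  shows "continuous_on UNIV (\<lambda>x. frechet_derivative (\<lambda>y. \<psi> y *\<^sub>R Y y) (at x) v)"
proof -
  have "((\<lambda>y. \<psi> y *\<^sub>R Y y) has_derivative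
      (\<lambda>v. \<psi> x *\<^sub>R frechet_derivative Y (at x) v + frechet_derivative \<psi> (at x) v *\<^sub>R Y x)) (at x)" for x
    using assms by (intro has_derivative_scaleR smooth_has_derivative)
  from frechet_derivative_at[OF this, symmetric] show ?thesis
    by (simp, intro continuous_intros smooth_continuous[OF assms(1)] smooth_continuous[OF assms(2)]
        smooth_continuous_derivative[OF assms(1)] smooth_continuous_derivative[OF assms(2)])
qed

lemma continuous_divergence:
  assumes "\<And>v. continuous_on UNIV (\<lambda>x. frechet_derivative V (at x) v)"
  shows "continuous_on UNIV (divergence V)"
  unfolding divergence_def using assms by (intro continuous_intros)

lemma divergence_outside_support:
  assumes "\<And>x. R < norm x \<Longrightarrow> V x = 0" "R < norm x"
  shows "divergence V x = 0"
  unfolding divergence_def by (simp add: frechet_derivative_outside_support[OF assms])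

text \<open>Continuity of the derivative is given one direction at a time, so its operator norm is
  controlled by the sum of its norms on the coordinate axes.\<close>

lemma smooth_lipschitz_cball:
  fixes Y :: "real^'n \<Rightarrow> real^'n"
  assumes "smooth Y"
  obtains L where "0 \<le> L" "\<And>x y. norm x \<le> R \<Longrightarrow> norm y \<le> R \<Longrightarrow> norm (Y x - Y y) \<le> L * norm (x - y)"
proof -
  let ?D = "\<lambda>x. frechet_derivative Y (at x)"
  let ?u = "\<lambda>x. \<Sum>j\<in>UNIV. norm (?D x (axis j 1))"
  have "continuous_on UNIV ?u"
    using assms by (intro continuous_intros smooth_continuous_derivative)
  then have "bounded (?u ` cball 0 R)"
    by (intro compact_imp_bounded compact_continuous_image) (auto intro: continuous_on_subset)
  then obtain L where L: "0 < L" "\<And>x. norm x \<le> R \<Longrightarrow> ?u x \<le> L"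
    by (force simp: bounded_pos)
  have "norm (Y x - Y y) \<le> L * norm (x - y)" if "norm x \<le> R" "norm y \<le> R" for x y
  proof (rule differentiable_bound[of "cball 0 R"])
    show "(Y has_derivative ?D z) (at z within cball 0 R)" for z
      using smooth_has_derivative[OF assms] has_derivative_at_withinI by blast
    show "onorm (?D z) \<le> L" if z: "z \<in> cball 0 R" for z
    proof (rule onorm_le)
      fix v :: "real^'n"
      have "v = (\<Sum>j\<in>UNIV. v $ j *\<^sub>R axis j 1)"
        by (metis basis_expansion scalar_mult_eq_scaleR)
      then have "?D z v = ?D z (\<Sum>j\<in>UNIV. v $ j *\<^sub>R axis j 1)" by simp
      also have "\<dots> = (\<Sum>j\<in>UNIV. v $ j *\<^sub>R ?D z (axis j 1))"
        using has_derivative_linear[OF smooth_has_derivative[OF assms]] by (simp add: linear_sum linear_scale)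
      also have "norm \<dots> \<le> (\<Sum>j\<in>UNIV. norm v * norm (?D z (axis j 1)))"
        by (intro sum_norm_le) (simp add: mult_right_mono component_le_norm_cart)
      also have "\<dots> \<le> L * norm v"
        using mult_right_mono[OF L(2)[of z] norm_ge_zero[of v]] z
          by (simp add: sum_distrib_left[symmetric] mult.commute)
      finally show "norm (?D z v) \<le> L * norm v" .
    qed
  qed (use that in auto)
  with L that show ?thesis by (meson less_imp_le)
qed

text \<open>Used to replace a mollified factor by the original one. Closeness is asked only where
  the weight \<open>p\<close> is nonzero, because in the product rule it is available only on
  balls.\<close>

lemma integral_mult_diff_le:
  fixes p q0 q1 :: "'a::euclidean_space \<Rightarrow> real"
  assumes p: "integrable M p" and q: "integrable M (\<lambda>x. p x * q0 x)" "integrable M (\<lambda>x. p x * q1 x)"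
    and le: "\<And>x. p x \<noteq> 0 \<Longrightarrow> \<bar>q1 x - q0 x\<bar> \<le> w"
  shows "\<bar>(LINT x|M. p x * q0 x) - (LINT x|M. p x * q1 x)\<bar> \<le> w * (LINT x|M. \<bar>p x\<bar>)"
proof -
  have "(LINT x|M. p x * q0 x) - (LINT x|M. p x * q1 x) = (LINT x|M. p x * q0 x - p x * q1 x)"
    using q by simp
  also have "\<bar>\<dots>\<bar> \<le> (LINT x|M. w * \<bar>p x\<bar>)"
  proof (rule integral_abs_bound_integral)
    show "\<bar>p x * q0 x - p x * q1 x\<bar> \<le> w * \<bar>p x\<bar>" for x
    proof (cases "p x = 0")
      case False
      have "\<bar>p x * q0 x - p x * q1 x\<bar> = \<bar>p x\<bar> * \<bar>q1 x - q0 x\<bar>"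
        by (simp add: abs_mult[symmetric] right_diff_distrib abs_minus_commute)
      also have "\<dots> \<le> \<bar>p x\<bar> * w" using le[OF False] by (intro mult_left_mono) auto
      finally show ?thesis by (simp add: mult.commute)
    qed simp
  qed (use p q in auto)
  finally show ?thesis by simp
qed

text \<open>
  Commutator of mollification with \<open>Y\<close>. Its integral over \<open>y\<close> vanishes by the divergence theorem,
  and its \<open>L\<^sup>1\<close> norm is bounded uniformly in the scale, so it tends to zero when tested against
  a continuous function.
\<close>

definition commutator_kernel :: "(real^'n \<Rightarrow> real^'n) \<Rightarrow> real \<Rightarrow> real^'n \<Rightarrow> real^'n \<Rightarrow> real" where
  "commutator_kernel Y e x y =
     moll e x y * divergence Y y - moll_slope e x y * ((x - y) \<bullet> (Y x - Y y))"

lemma smooth_continuous_divergence: "smooth Y \<Longrightarrow> continuous_on A (divergence Y)"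
  using continuous_divergence smooth_continuous_derivative continuous_on_subset subset_UNIV by metis

lemma commutator_kernel_support:
  "0 < e \<Longrightarrow> e \<le> dist y x \<Longrightarrow> commutator_kernel Y e x y = 0"
  by (simp add: commutator_kernel_def moll_eq_0 moll_slope_eq_0)

lemma commutator_kernel_continuous:
  assumes Y: "smooth Y"
  shows "continuous_on A (commutator_kernel Y e x)"
  unfolding commutator_kernel_def
  by (intro continuous_intros moll_slope_continuous_snd smooth_continuous[OF moll_smooth]
      smooth_continuous[OF Y] smooth_continuous_divergence[OF Y])

lemma integrable_commutator_kernel:
  assumes "smooth Y" "0 < e"
  shows "integrable lborel (commutator_kernel Y e x)"
proof (rule integrable_compact_support[OF commutator_kernel_continuous[OF assms(1)]])
  show "commutator_kernel Y e x y = 0" if "norm x + e < norm y" for y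
    using that assms norm_triangle_ineq2[of y x] by (intro commutator_kernel_support) (auto simp: dist_norm)
qed

text \<open>With \<open>x\<close> frozen, the kernel is the divergence in \<open>y\<close> of the
  compactly supported field \<open>moll e x y *\<^sub>R (Y y - Y x)\<close>.\<close>

lemma integral_commutator_kernel:
  fixes Y :: "real^'n \<Rightarrow> real^'n"
  assumes Y: "smooth Y" and e: "0 < e"
  shows "(LINT y|lborel. commutator_kernel Y e x y) = 0"
proof -
  let ?W = "\<lambda>y. Y y - Y x"
  have DW: "(?W has_derivative frechet_derivative Y (at y)) (at y)" for y
    using smooth_has_derivative[OF Y, of y] by (auto intro!: derivative_eq_intros)
  have eqW: "frechet_derivative ?W (at y) = frechet_derivative Y (at y)" for y
    using frechet_derivative_at[OF DW] by simp
  have DV: "((\<lambda>y. moll e x y *\<^sub>R ?W y) has_derivative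
      (\<lambda>v. moll e x y *\<^sub>R frechet_derivative Y (at y) v + (- moll_slope e x y * ((y - x) \<bullet> v)) *\<^sub>R ?W y)) (at y)" for y
    by (intro has_derivative_scaleR moll_has_derivative DW)
  have eqV: "frechet_derivative (\<lambda>y. moll e x y *\<^sub>R ?W y) (at y) =
      (\<lambda>v. moll e x y *\<^sub>R frechet_derivative Y (at y) v + (- moll_slope e x y * ((y - x) \<bullet> v)) *\<^sub>R ?W y)" for y
    using frechet_derivative_at[OF DV] by simp
  have "divergence (\<lambda>y. moll e x y *\<^sub>R ?W y) y = commutator_kernel Y e x y" for y
    using DW unfolding commutator_kernel_def
    by (subst divergence_scaleR[OF moll_has_derivative])
       (auto simp: differentiable_def divergence_def eqW algebra_simps inner_diff_left inner_diff_right)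
  moreover have "(LINT y|lborel. divergence (\<lambda>y. moll e x y *\<^sub>R ?W y) y) = 0"
  proof (rule integral_divergence_eq_0)
    show "continuous_on UNIV (\<lambda>y. frechet_derivative (\<lambda>y. moll e x y *\<^sub>R ?W y) (at y) v)" for v
      unfolding eqV
      by (intro continuous_intros moll_slope_continuous_snd smooth_continuous[OF moll_smooth]
          smooth_continuous[OF Y] smooth_continuous_derivative[OF Y])
    show "moll e x y *\<^sub>R ?W y = 0" if "norm x + e < norm y" for y
      using moll_support[OF e that] by simp
  qed (use DV in \<open>auto simp: differentiable_def\<close>)
  ultimately show ?thesis by simp
qed

text \<open>The slope is singular as \<open>e\<close> shrinks, but it meets
  \<open>(x - y) \<bullet> (Y x - Y y)\<close>, which is at most a Lipschitz constant times the
  squared distance; that second moment is \<open>CARD('n)\<close> at every scale. The constants are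
  taken on the ball of radius \<open>R + 1\<close> since \<open>e \<le> 1\<close>.\<close>

lemma commutator_kernel_L1_bound:
  fixes Y :: "real^'n \<Rightarrow> real^'n"
  assumes Y: "smooth Y"
  obtains C where "0 \<le> C"
    "\<And>e x. 0 < e \<Longrightarrow> e \<le> 1 \<Longrightarrow> norm x \<le> R \<Longrightarrow> (LINT y|lborel. \<bar>commutator_kernel Y e x y\<bar>) \<le> C"
proof -
  obtain L where L: "0 \<le> L" "\<And>x y. norm x \<le> R + 1 \<Longrightarrow> norm y \<le> R + 1 \<Longrightarrow> norm (Y x - Y y) \<le> L * norm (x - y)"
    using smooth_lipschitz_cball[OF Y] by metis
  have "bounded (divergence Y ` cball 0 (R + 1))"
    by (intro compact_imp_bounded compact_continuous_image smooth_continuous_divergence Y compact_cball)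
  then obtain D where D: "0 < D" "\<And>y. norm y \<le> R + 1 \<Longrightarrow> \<bar>divergence Y y\<bar> \<le> D"
    by (force simp: bounded_pos)
  have "(LINT y|lborel. \<bar>commutator_kernel Y e x y\<bar>) \<le> D + L * CARD('n)"
    if e: "0 < e" "e \<le> 1" and x: "norm x \<le> R" for e x
  proof -
    let ?m = "\<lambda>y. moll e x y * D + L * (moll_slope e x y * (norm (y - x))\<^sup>2)"
    have "(LINT y|lborel. \<bar>commutator_kernel Y e x y\<bar>) \<le> (LINT y|lborel. ?m y)"
    proof (rule integral_mono)
      show "integrable lborel (\<lambda>y. \<bar>commutator_kernel Y e x y\<bar>)"
        using integrable_commutator_kernel[OF Y e(1)] by (rule integrable_abs)
      show "integrable lborel ?m"
        by (intro Bochner_Integration.integrable_add integrable_mult_left integrable_mult_right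
            integrable_moll integrable_moll_slope e)
      show "\<bar>commutator_kernel Y e x y\<bar> \<le> ?m y" for y
      proof (cases "dist y x < e")
        case True
        then have y: "norm y \<le> R + 1" using norm_triangle_ineq2[of y x] e x by (auto simp: dist_norm)
        have "\<bar>(x - y) \<bullet> (Y x - Y y)\<bar> \<le> norm (x - y) * norm (Y x - Y y)"
          by (rule Cauchy_Schwarz_ineq2)
        also have "\<dots> \<le> norm (x - y) * (L * norm (x - y))"
          using x y by (intro mult_left_mono L) auto
        finally have "\<bar>(x - y) \<bullet> (Y x - Y y)\<bar> \<le> L * (norm (y - x))\<^sup>2"
          by (simp add: power2_eq_square norm_minus_commute mult_ac)
        then have 1: "moll_slope e x y * \<bar>(x - y) \<bullet> (Y x - Y y)\<bar> \<le> moll_slope e x y * (L * (norm (y - x))\<^sup>2)"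
          using moll_slope_nonneg[OF e(1)] by (intro mult_left_mono) auto
        have 2: "moll e x y * \<bar>divergence Y y\<bar> \<le> moll e x y * D"
          using D(2)[OF y] moll_nonneg[OF e(1)] by (intro mult_left_mono) auto
        have "\<bar>commutator_kernel Y e x y\<bar> \<le> moll e x y * \<bar>divergence Y y\<bar> + moll_slope e x y * \<bar>(x - y) \<bullet> (Y x - Y y)\<bar>"
          unfolding commutator_kernel_def
          using abs_triangle_ineq4 moll_nonneg[OF e(1), of x y] moll_slope_nonneg[OF e(1), of x y]
          by (metis abs_mult abs_of_nonneg)
        with 1 2 show ?thesis by (simp add: mult_ac)
      next
        case False
        then show ?thesis
          using e commutator_kernel_support[of e y x] moll_eq_0[of e y x] moll_slope_eq_0[of e y x] by simp
      qed
    qed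
    also have "\<dots> = D + L * CARD('n)"
      using integrable_moll[OF e(1), of x] integrable_moll_slope[OF e(1), of x]
      by (simp add: integral_moll[OF e(1)] integral_moll_slope[OF e(1)])
    finally show ?thesis .
  qed
  moreover have "0 \<le> D + L * CARD('n)" using D L by simp
  ultimately show ?thesis using that by blast
qed

section \<open>The product rule for weak derivatives\<close>

lemma test_function_smooth: "test_function \<phi> \<Longrightarrow> smooth \<phi>"
  by (simp add: test_function_def)

text \<open>The equation of \<open>f\<close> is tested in \<open>x\<close> with
  \<open>moll e y x * \<psi> x\<close> and integrated against the cut-off \<open>g y\<close>; that
  of \<open>g\<close> is tested in \<open>y\<close> with \<open>moll e x y\<close> and integrated
  against \<open>f x * \<psi> x\<close>. The sum is an identity exact for each small
  \<open>e\<close>, in which the derivatives of the mollifier combine into the commutator. Shrinking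
  \<open>e\<close> restores the diagonal.\<close>

lemma has_weak_deriv_mult:
  fixes Y :: "real^'n \<Rightarrow> real^'n"
  assumes Y: "smooth Y" and f: "continuous_on UNIV f" and g: "continuous_on UNIV g"
    and fh: "has_weak_deriv Y f h" and gk: "has_weak_deriv Y g k"
  shows "has_weak_deriv Y (\<lambda>x. f x * g x) (\<lambda>x. h x * g x + k x * f x)"
  unfolding has_weak_deriv_def
proof (intro conjI allI impI)
  have h: "h \<in> L1_loc" and k: "k \<in> L1_loc" using fh gk by (auto simp: has_weak_deriv_def)
  then have hg: "(\<lambda>x. h x * g x) \<in> L1_loc" and kf: "(\<lambda>x. k x * f x) \<in> L1_loc"
    using f g L1_loc_mult_continuous by blast+
  then show "(\<lambda>x. h x * g x + k x * f x) \<in> L1_loc"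
    by (auto simp: L1_loc_def intro!: set_integral_add)
  fix \<psi> :: "real^'n \<Rightarrow> real"
  assume \<psi>: "test_function \<psi>"
  then have s\<psi>: "smooth \<psi>" and c\<psi>: "continuous_on A \<psi>" for A
    by (auto simp: test_function_smooth smooth_continuous)
  obtain R where R: "0 < R" "\<And>x. R < norm x \<Longrightarrow> \<psi> x = 0"
    using test_function_support[OF \<psi>] by blast
  \<comment> \<open>Up to sign, \<open>U\<close> is the formal adjoint of \<open>Y\<close> applied
    to \<open>\<psi>\<close>.\<close>
  define U where "U = divergence (\<lambda>y. \<psi> y *\<^sub>R Y y)"
  have cU: "continuous_on UNIV U"
    unfolding U_def by (intro continuous_divergence continuous_frechet_scaleR s\<psi> Y)
  have U0: "U x = 0" if "R < norm x" for x
    unfolding U_def by (rule divergence_outside_support[OF _ that]) (simp add: R)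
  \<comment> \<open>The cutoff makes \<open>g\<close> and \<open>k\<close> globally integrable. Its
    radius is \<open>R + 1\<close> because \<open>x\<close> stays in the support of
    \<open>\<psi>\<close> and \<open>y\<close> within distance 1 of \<open>x\<close>.\<close>
  define I where "I = (indicator (cball 0 (R + 1)) :: real^'n \<Rightarrow> real)"
  have I0: "I y = 0" if "R + 1 < norm y" for y using that by (simp add: I_def indicator_def)
  have I1: "I y = 1" if "norm y \<le> R + 1" for y using that by (simp add: I_def indicator_def)
  have ig: "integrable lborel (\<lambda>y. I y * g y)"
    using borel_integrable_compact[OF compact_cball continuous_on_subset[OF g subset_UNIV]] by (simp add: I_def)
  have ik: "integrable lborel (\<lambda>y. I y * k y)"
    using k by (simp add: I_def L1_loc_def set_integrable_def)
  have ih\<psi>: "integrable lborel (\<lambda>x. h x * \<psi> x)"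
    by (rule L1_loc_integrable[OF L1_loc_mult_continuous[OF h c\<psi>], of R]) (simp add: R)
  have if\<psi>: "integrable lborel (\<lambda>x. f x * \<psi> x)"
    by (rule integrable_compact_support[of _ R]) (auto intro!: continuous_intros f c\<psi> simp: R)
  have ifU: "integrable lborel (\<lambda>x. f x * U x)"
    by (rule integrable_compact_support[of _ R]) (auto intro!: continuous_intros f cU simp: U0)

  obtain C where C: "0 \<le> C"
    "\<And>e x. 0 < e \<Longrightarrow> e \<le> 1 \<Longrightarrow> norm x \<le> R \<Longrightarrow> (LINT y|lborel. \<bar>commutator_kernel Y e x y\<bar>) \<le> C"
    using commutator_kernel_L1_bound[OF Y] by blast
  \<comment> \<open>\<open>B\<close> collects the L1 norms of the four weights: each approximation
    costs at most \<open>w\<close> times its weight, the commutator an extra factor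
    \<open>C\<close>.\<close>
  define B where "B = (LINT x|lborel. \<bar>h x * \<psi> x\<bar>) + (LINT x|lborel. \<bar>I x * k x\<bar>)
    + (LINT x|lborel. \<bar>f x * U x\<bar>) + C * (LINT x|lborel. \<bar>f x * \<psi> x\<bar>)"
  \<comment> \<open>\<open>S = 0\<close> is the claimed identity tested with \<open>\<psi>\<close>;
    the cutoff in the middle term equals 1 on the support of \<open>\<psi>\<close>.\<close>
  define S where "S = (LINT x|lborel. h x * \<psi> x * g x) + (LINT y|lborel. I y * k y * (f y * \<psi> y))
    + (LINT x|lborel. f x * U x * g x)"

  have "\<bar>S\<bar> \<le> w * B" if w: "0 < w" for w
  proof -
    \<comment> \<open>Radius \<open>R + 2\<close> leaves room for two short steps: from the support
      of \<open>\<psi>\<close> into the cutoff ball, and from there to a neighbouring point when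
      \<open>P\<close> is estimated.\<close>
    have "uniformly_continuous_on (cball 0 (R + 2)) g"
      "uniformly_continuous_on (cball 0 (R + 2)) (\<lambda>x. f x * \<psi> x)"
      by (intro compact_uniformly_continuous continuous_intros c\<psi> continuous_on_subset[OF f]
          continuous_on_subset[OF g] compact_cball subset_UNIV)+
    then obtain d1 d2 where d: "0 < d1" "0 < d2"
      "\<And>x y. norm x \<le> R + 2 \<Longrightarrow> norm y \<le> R + 2 \<Longrightarrow> dist y x < d1 \<Longrightarrow> dist (g y) (g x) < w"
      "\<And>x y. norm x \<le> R + 2 \<Longrightarrow> norm y \<le> R + 2 \<Longrightarrow> dist y x < d2 \<Longrightarrow> dist (f y * \<psi> y) (f x * \<psi> x) < w"
      using w unfolding uniformly_continuous_on_def by (simp add: Ball_def) metis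
    define e where "e = min 1 (min d1 d2)"
    have e: "0 < e" "e \<le> 1" "e \<le> d1" "e \<le> d2" using d by (auto simp: e_def)
    have near: "norm y \<le> norm x + 1" if "dist y x < e" for x y :: "real^'n"
      using that e norm_triangle_ineq2[of y x] by (simp add: dist_norm)

    let ?K = "\<lambda>x y. commutator_kernel Y e x y"
    \<comment> \<open>\<open>?k2\<close> is the derivative of the mollifier in \<open>x\<close>
      along \<open>Y x\<close>, and \<open>?k3\<close> the divergence in \<open>y\<close> of the
      mollifier times \<open>Y y\<close>. Only their sum, the commutator kernel, is controlled
      uniformly in \<open>e\<close>.\<close>
    let ?k2 = "\<lambda>x y. - moll_slope e y x * ((x - y) \<bullet> Y x)"
    let ?k3 = "\<lambda>x y. moll e x y * divergence Y y - moll_slope e x y * ((y - x) \<bullet> Y y)"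
    have K_eq: "?K x y = ?k2 x y + ?k3 x y" for x y
      by (simp add: commutator_kernel_def moll_slope_sym[of e y x] algebra_simps inner_diff_left inner_diff_right)
    have c1: "continuous_on UNIV (\<lambda>z. moll e (snd z) (fst z))" by (rule moll_continuous)
    have c2: "continuous_on UNIV (\<lambda>z. ?k2 (fst z) (snd z))"
      by (intro continuous_intros moll_slope_continuous continuous_on_compose2[OF smooth_continuous[OF Y, of UNIV]]) auto
    have c3: "continuous_on UNIV (\<lambda>z. ?k3 (fst z) (snd z))"
      unfolding moll_sym[of e "fst _"] moll_slope_sym[of e "fst _"]
      by (intro continuous_intros moll_slope_continuous moll_continuous
          continuous_on_compose2[OF smooth_continuous[OF Y, of UNIV]]
          continuous_on_compose2[OF smooth_continuous_divergence[OF Y, of UNIV]]) auto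
    let ?P2 = "(lborel \<Otimes>\<^sub>M lborel :: ((real^'n) \<times> (real^'n)) measure)"

    have i1: "integrable ?P2 (\<lambda>(x, y). (h x * \<psi> x) * (I y * g y) * moll e y x)"
      by (rule integrable_kernel[OF ih\<psi> _ ig _ c1, of R "R + 1"]) (auto simp: R I0)
    have i2: "integrable ?P2 (\<lambda>(x, y). (f x * U x) * (I y * g y) * moll e y x)"
      by (rule integrable_kernel[OF ifU _ ig _ c1, of R "R + 1"]) (auto simp: U0 I0)
    have i3: "integrable ?P2 (\<lambda>(x, y). (f x * \<psi> x) * (I y * g y) * ?k2 x y)"
      by (rule integrable_kernel[OF if\<psi> _ ig _ c2, of R "R + 1"]) (auto simp: R I0)
    have i4: "integrable ?P2 (\<lambda>(x, y). (f x * \<psi> x) * (I y * g y) * ?k3 x y)"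
      by (rule integrable_kernel[OF if\<psi> _ ig _ c3, of R "R + 1"]) (auto simp: R I0)
    have i5: "integrable ?P2 (\<lambda>(x, y). (f x * \<psi> x) * (I y * k y) * moll e y x)"
      by (rule integrable_kernel[OF if\<psi> _ ik _ c1, of R "R + 1"]) (auto simp: R I0)
    note fst_eq = lborel_pair.integral_fst and snd_eq = lborel_pair.integral_snd
    note fst_int = lborel_pair.integrable_fst and snd_int = lborel_pair.integrable_snd

    have weak_f: "(LINT x|lborel. h x * \<psi> x * moll e y x)
        = - (LINT x|lborel. f x * U x * moll e y x) - (LINT x|lborel. f x * \<psi> x * ?k2 x y)" for y
    proof -
      have "divergence (\<lambda>x. moll e y x *\<^sub>R (\<psi> x *\<^sub>R Y x)) x = moll e y x * U x + \<psi> x * ?k2 x y" for x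
        unfolding U_def
        by (subst divergence_scaleR[OF moll_has_derivative])
           (auto simp: differentiable_def intro!: exI has_derivative_scaleR smooth_has_derivative s\<psi> Y)
      moreover have "test_function (\<lambda>x. moll e y x * \<psi> x)"
        using test_function_mult[OF \<psi> moll_smooth] .
      then have "(LINT x|lborel. h x * (moll e y x * \<psi> x))
          = - (LINT x|lborel. f x * divergence (\<lambda>x. (moll e y x * \<psi> x) *\<^sub>R Y x) x)"
        using fh unfolding has_weak_deriv_def by blast
      ultimately have "(LINT x|lborel. h x * (moll e y x * \<psi> x))
          = - (LINT x|lborel. f x * (moll e y x * U x + \<psi> x * ?k2 x y))"
        by (simp only: scaleR_scaleR[symmetric])
      moreover have "h x * (moll e y x * \<psi> x) = h x * \<psi> x * moll e y x"
        "f x * (moll e y x * U x + \<psi> x * ?k2 x y) = f x * U x * moll e y x + f x * \<psi> x * ?k2 x y" for x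
        by (simp_all add: algebra_simps)
      ultimately have "(LINT x|lborel. h x * \<psi> x * moll e y x)
          = - (LINT x|lborel. f x * U x * moll e y x + f x * \<psi> x * ?k2 x y)"
        by (simp only:)
      also have "(LINT x|lborel. f x * U x * moll e y x + f x * \<psi> x * ?k2 x y)
          = (LINT x|lborel. f x * U x * moll e y x) + (LINT x|lborel. f x * \<psi> x * ?k2 x y)"
      proof (rule Bochner_Integration.integral_add)
        show "integrable lborel (\<lambda>x. f x * U x * moll e y x)"
          by (rule integrable_compact_support[of _ R])
             (auto intro!: continuous_intros f cU smooth_continuous[OF moll_smooth] simp: U0)
        show "integrable lborel (\<lambda>x. f x * \<psi> x * ?k2 x y)"
          by (rule integrable_compact_support[of _ R])
             (auto intro!: continuous_intros f c\<psi> moll_slope_continuous_snd smooth_continuous[OF Y] simp: R)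
      qed
      finally show ?thesis by simp
    qed
    have weak_g: "(LINT y|lborel. I y * k y * moll e y x) = - (LINT y|lborel. I y * g y * ?k3 x y)"
      if x: "norm x \<le> R" for x
    proof -
      have "divergence (\<lambda>y. moll e x y *\<^sub>R Y y) y = ?k3 x y" for y
        using smooth_has_derivative[OF Y]
        by (subst divergence_scaleR[OF moll_has_derivative]) (auto simp: differentiable_def)
      then have "(LINT y|lborel. k y * moll e x y) = - (LINT y|lborel. g y * ?k3 x y)"
        using gk test_function_moll[OF e(1), of x] unfolding has_weak_deriv_def by simp
      \<comment> \<open>From \<open>norm x \<le> R\<close> the mollifier reaches only points where
        the cutoff is 1, so inserting \<open>I\<close> leaves the integrals unchanged.\<close>
      moreover have "k y * moll e x y = I y * k y * moll e y x \<and> g y * ?k3 x y = I y * g y * ?k3 x y" for y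
      proof (cases "dist y x < e")
        case True
        then show ?thesis using near[OF True] x I1[of y] by (simp add: moll_sym[of e x y])
      next
        case False
        then have "e \<le> dist x y" "e \<le> dist y x" by (simp_all add: dist_commute)
        then show ?thesis using e by (simp add: moll_eq_0 moll_slope_eq_0)
      qed
      ultimately show ?thesis by simp
    qed

    define G where "G x = (LINT y|lborel. I y * g y * moll e y x)" for x
    define P where "P y = (LINT x|lborel. f x * \<psi> x * moll e y x)" for y
    define Q where "Q x = (LINT y|lborel. I y * g y * ?K x y)" for x

    have "(LINT x|lborel. h x * \<psi> x * G x)
        = (LINT y|lborel. LINT x|lborel. (h x * \<psi> x) * (I y * g y) * moll e y x)"
      unfolding G_def snd_eq[OF i1] fst_eq[OF i1, symmetric] by (simp add: mult.assoc)
    also have "\<dots> = (LINT y|lborel. I y * g y * (LINT x|lborel. h x * \<psi> x * moll e y x))"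
      by (simp add: mult_ac flip: integral_mult_right_zero)
    also have "\<dots> = (LINT y|lborel. - (LINT x|lborel. (f x * U x) * (I y * g y) * moll e y x)
        - (LINT x|lborel. (f x * \<psi> x) * (I y * g y) * ?k2 x y))"
      unfolding weak_f by (simp add: right_diff_distrib mult_ac flip: integral_mult_right_zero)
    also have "\<dots> = - (LINT y|lborel. LINT x|lborel. (f x * U x) * (I y * g y) * moll e y x)
        - (LINT y|lborel. LINT x|lborel. (f x * \<psi> x) * (I y * g y) * ?k2 x y)"
      using snd_int[OF i2] snd_int[OF i3] by simp
    finally have T1: "(LINT x|lborel. h x * \<psi> x * G x) =
        - integral\<^sup>L ?P2 (\<lambda>(x, y). (f x * U x) * (I y * g y) * moll e y x)
        - integral\<^sup>L ?P2 (\<lambda>(x, y). (f x * \<psi> x) * (I y * g y) * ?k2 x y)"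
      unfolding snd_eq[OF i2] snd_eq[OF i3] .
    have T3: "(LINT x|lborel. f x * U x * G x)
        = integral\<^sup>L ?P2 (\<lambda>(x, y). (f x * U x) * (I y * g y) * moll e y x)"
      unfolding G_def fst_eq[OF i2, symmetric] by (simp add: mult.assoc)
    have "(LINT y|lborel. I y * k y * P y)
        = (LINT x|lborel. LINT y|lborel. (f x * \<psi> x) * (I y * k y) * moll e y x)"
      unfolding P_def fst_eq[OF i5] snd_eq[OF i5, symmetric]
      by (simp add: mult_ac flip: integral_mult_right_zero)
    also have "\<dots> = (LINT x|lborel. - (LINT y|lborel. (f x * \<psi> x) * (I y * g y) * ?k3 x y))"
    proof (rule Bochner_Integration.integral_cong[OF refl])
      fix x
      show "(LINT y|lborel. (f x * \<psi> x) * (I y * k y) * moll e y x)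
          = - (LINT y|lborel. (f x * \<psi> x) * (I y * g y) * ?k3 x y)"
      proof (cases "norm x \<le> R")
        case True
        then show ?thesis using weak_g[OF True] by (simp add: mult.assoc)
      next
        case False
        then show ?thesis using R(2)[of x] by simp
      qed
    qed
    finally have T2: "(LINT y|lborel. I y * k y * P y)
        = - integral\<^sup>L ?P2 (\<lambda>(x, y). (f x * \<psi> x) * (I y * g y) * ?k3 x y)"
      by (simp add: fst_eq[OF i4])
    have K_sum: "(\<lambda>(x, y). (f x * \<psi> x) * (I y * g y) * ?K x y)
        = (\<lambda>z. (case z of (x, y) \<Rightarrow> (f x * \<psi> x) * (I y * g y) * ?k2 x y)
            + (case z of (x, y) \<Rightarrow> (f x * \<psi> x) * (I y * g y) * ?k3 x y))"
      unfolding K_eq by (simp add: fun_eq_iff algebra_simps)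
    have i6: "integrable ?P2 (\<lambda>(x, y). (f x * \<psi> x) * (I y * g y) * ?K x y)"
      unfolding K_sum using i3 i4 by (rule Bochner_Integration.integrable_add)
    have T4: "(LINT x|lborel. f x * \<psi> x * Q x) =
        integral\<^sup>L ?P2 (\<lambda>(x, y). (f x * \<psi> x) * (I y * g y) * ?k2 x y)
        + integral\<^sup>L ?P2 (\<lambda>(x, y). (f x * \<psi> x) * (I y * g y) * ?k3 x y)"
    proof -
      have "(LINT x|lborel. f x * \<psi> x * Q x) = integral\<^sup>L ?P2 (\<lambda>(x, y). (f x * \<psi> x) * (I y * g y) * ?K x y)"
        unfolding Q_def fst_eq[OF i6, symmetric] by (simp add: mult.assoc)
      then show ?thesis
        unfolding K_sum Bochner_Integration.integral_add[OF i3 i4] .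
    qed
    \<comment> \<open>The integrals with \<open>U\<close> cancel between \<open>T1\<close> and
      \<open>T3\<close>, those with \<open>?k2\<close> between \<open>T1\<close> and
      \<open>T4\<close>, those with \<open>?k3\<close> between \<open>T2\<close> and
      \<open>T4\<close>. No limit has been taken yet.\<close>
    have eq: "(LINT x|lborel. h x * \<psi> x * G x) + (LINT y|lborel. I y * k y * P y)
        + (LINT x|lborel. f x * U x * G x) + (LINT x|lborel. f x * \<psi> x * Q x) = 0"
      unfolding T1 T2 T3 T4 by simp

    have int_g_moll: "integrable lborel (\<lambda>y. I y * g y * moll e x y)" for x
    proof -
      have "integrable lborel (\<lambda>y. indicator (cball 0 (R + 1)) y *\<^sub>R (g y * moll e x y))"
        by (intro borel_integrable_compact compact_cball continuous_intros
            continuous_on_subset[OF g] smooth_continuous[OF moll_smooth] subset_UNIV)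
      then show ?thesis by (simp add: I_def mult.assoc)
    qed
    have G: "\<bar>G x - g x\<bar> \<le> w" if x: "norm x \<le> R" for x
      unfolding G_def moll_sym[of e _ x]
    proof (rule moll_average[OF e(1) int_g_moll])
      show "\<bar>I y * g y - g x\<bar> \<le> w" if "dist y x < e" for y
        using d(3)[of x y] near[OF that] x that e I1[of y] by (simp add: dist_real_def)
    qed
    have P: "\<bar>P y - f y * \<psi> y\<bar> \<le> w" if y: "norm y \<le> R + 1" for y
      unfolding P_def
    proof (rule moll_average[OF e(1)])
      show "integrable lborel (\<lambda>x. f x * \<psi> x * moll e y x)"
        by (rule integrable_compact_support[of _ R])
           (auto intro!: continuous_intros f c\<psi> smooth_continuous[OF moll_smooth] simp: R)
      show "\<bar>f x * \<psi> x - f y * \<psi> y\<bar> \<le> w" if "dist x y < e" for x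
        using d(4)[of y x] near[OF that] y that e by (simp add: dist_real_def)
    qed
    have Q: "\<bar>Q x\<bar> \<le> w * C" if x: "norm x \<le> R" for x
    proof -
      note iK = integrable_commutator_kernel[OF Y e(1), of x]
      have igK: "integrable lborel (\<lambda>y. I y * g y * ?K x y)"
      proof -
        have "integrable lborel (\<lambda>y. indicator (cball 0 (R + 1)) y *\<^sub>R (g y * ?K x y))"
          by (intro borel_integrable_compact compact_cball continuous_intros
              continuous_on_subset[OF g] commutator_kernel_continuous[OF Y] subset_UNIV)
        then show ?thesis by (simp add: I_def mult.assoc)
      qed
      \<comment> \<open>The kernel has integral zero, so the constant \<open>g x\<close> may be
        subtracted; then only the oscillation of \<open>g\<close> at scale \<open>e\<close> meets
        the L1 bound.\<close>
      have "Q x = (LINT y|lborel. (I y * g y - g x) * ?K x y)"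
        unfolding Q_def using igK iK by (simp add: left_diff_distrib integral_commutator_kernel[OF Y e(1)])
      also have "\<bar>\<dots>\<bar> \<le> (LINT y|lborel. w * \<bar>?K x y\<bar>)"
      proof (rule integral_abs_bound_integral)
        show "integrable lborel (\<lambda>y. (I y * g y - g x) * ?K x y)"
          using igK iK by (simp add: left_diff_distrib)
        show "integrable lborel (\<lambda>y. w * \<bar>?K x y\<bar>)" using iK by simp
        show "\<bar>(I y * g y - g x) * ?K x y\<bar> \<le> w * \<bar>?K x y\<bar>" for y
        proof (cases "dist y x < e")
          case True
          then have "\<bar>I y * g y - g x\<bar> \<le> w"
            using d(3)[of x y] near[OF True] x e I1[of y] by (simp add: dist_real_def)
          then show ?thesis by (simp add: abs_mult mult_right_mono)
        next
          case False
          then show ?thesis using e by (simp add: commutator_kernel_support)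
        qed
      qed
      also have "\<dots> \<le> w * C" using C(2)[OF e(1,2) x] w by simp
      finally show ?thesis .
    qed

    have 1: "\<bar>(LINT x|lborel. h x * \<psi> x * g x) - (LINT x|lborel. h x * \<psi> x * G x)\<bar> \<le> w * (LINT x|lborel. \<bar>h x * \<psi> x\<bar>)"
    proof (rule integral_mult_diff_le[OF ih\<psi>])
      show "integrable lborel (\<lambda>x. h x * \<psi> x * g x)"
        by (rule L1_loc_integrable[OF L1_loc_mult_continuous[OF L1_loc_mult_continuous[OF h c\<psi>] g], of R])
           (simp add: R)
      show "integrable lborel (\<lambda>x. h x * \<psi> x * G x)"
        using fst_int[OF i1] by (simp add: G_def mult.assoc)
    qed (use G R in \<open>force simp: not_less\<close>)
    have 2: "\<bar>(LINT y|lborel. I y * k y * (f y * \<psi> y)) - (LINT y|lborel. I y * k y * P y)\<bar> \<le> w * (LINT y|lborel. \<bar>I y * k y\<bar>)"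
    proof (rule integral_mult_diff_le[OF ik])
      have "integrable lborel (\<lambda>x. k x * f x * \<psi> x)"
        by (rule L1_loc_integrable[OF L1_loc_mult_continuous[OF L1_loc_mult_continuous[OF k f] c\<psi>], of R])
           (simp add: R)
      moreover have "k y * f y * \<psi> y = I y * k y * (f y * \<psi> y)" for y
        using I1[of y] R(2)[of y] by (cases "norm y \<le> R") auto
      ultimately show "integrable lborel (\<lambda>y. I y * k y * (f y * \<psi> y))" by simp
      show "integrable lborel (\<lambda>y. I y * k y * P y)"
        using snd_int[OF i5] by (simp add: P_def mult_ac flip: integral_mult_right_zero)
    qed (use P I0 in \<open>force simp: not_less\<close>)
    have 3: "\<bar>(LINT x|lborel. f x * U x * g x) - (LINT x|lborel. f x * U x * G x)\<bar> \<le> w * (LINT x|lborel. \<bar>f x * U x\<bar>)"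
    proof (rule integral_mult_diff_le[OF ifU])
      show "integrable lborel (\<lambda>x. f x * U x * g x)"
        by (rule integrable_compact_support[of _ R]) (auto intro!: continuous_intros f g cU simp: U0)
      show "integrable lborel (\<lambda>x. f x * U x * G x)"
        using fst_int[OF i2] by (simp add: G_def mult.assoc)
    qed (use G U0 in \<open>force simp: not_less\<close>)
    \<comment> \<open>The comparison value is 0: the commutator term has no counterpart in
      \<open>S\<close>.\<close>
    have 4: "\<bar>(LINT x|lborel. f x * \<psi> x * 0) - (LINT x|lborel. f x * \<psi> x * Q x)\<bar> \<le> w * C * (LINT x|lborel. \<bar>f x * \<psi> x\<bar>)"
    proof (rule integral_mult_diff_le[OF if\<psi>])
      show "integrable lborel (\<lambda>x. f x * \<psi> x * Q x)"
        using fst_int[OF i6] by (simp add: Q_def mult.assoc)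
    qed (use Q R in \<open>force simp: not_less\<close>)+
    show ?thesis using 1 2 3 4 eq by (simp add: S_def B_def algebra_simps)
  qed
  note le = this
  have B0: "0 \<le> B" unfolding B_def using C(1) by (intro add_nonneg_nonneg mult_nonneg_nonneg) auto
  have "\<bar>S\<bar> \<le> 0"
  proof (rule field_le_epsilon)
    fix v :: real assume v: "0 < v"
    \<comment> \<open>The added 1 keeps the denominator positive when \<open>B = 0\<close>.\<close>
    then have "\<bar>S\<bar> \<le> v / (B + 1) * B" using B0 by (intro le) auto
    also have "\<dots> \<le> v" using B0 v by (simp add: field_simps)
    finally show "\<bar>S\<bar> \<le> 0 + v" by simp
  qed
  then have "S = 0" by simp
  moreover have "I y * k y * (f y * \<psi> y) = k y * f y * \<psi> y" for y
    using I1[of y] R(2)[of y] by (cases "norm y \<le> R") auto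
  then have "(\<lambda>y. I y * k y * (f y * \<psi> y)) = (\<lambda>y. k y * f y * \<psi> y)" by blast
  moreover have "integrable lborel (\<lambda>x. h x * g x * \<psi> x)" "integrable lborel (\<lambda>x. k x * f x * \<psi> x)"
    by (rule L1_loc_integrable[OF L1_loc_mult_continuous[OF hg c\<psi>], of R]
        L1_loc_integrable[OF L1_loc_mult_continuous[OF kf c\<psi>], of R], simp add: R)+
  then have "(LINT x|lborel. (h x * g x + k x * f x) * \<psi> x)
      = (LINT x|lborel. h x * g x * \<psi> x) + (LINT x|lborel. k x * f x * \<psi> x)"
    by (simp add: distrib_right)
  ultimately show "(LINT x|lborel. (h x * g x + k x * f x) * \<psi> x)
      = - (LINT x|lborel. f x * g x * divergence (\<lambda>y. \<psi> y *\<^sub>R Y y) x)"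
    by (simp add: S_def U_def mult_ac)
qed

section \<open>Weak derivatives of exponentials\<close>

lemma test_divergence_support:
  fixes Y :: "real^'n \<Rightarrow> real^'n"
  assumes Y: "smooth Y" and \<psi>: "test_function \<psi>"
  obtains R where "continuous_on UNIV (divergence (\<lambda>y. \<psi> y *\<^sub>R Y y))"
    "\<And>x. R < norm x \<Longrightarrow> divergence (\<lambda>y. \<psi> y *\<^sub>R Y y) x = 0" "\<And>x. R < norm x \<Longrightarrow> \<psi> x = 0"
proof -
  obtain R where R: "\<And>x. R < norm x \<Longrightarrow> \<psi> x = 0"
    using test_function_support[OF \<psi>] by blast
  have "divergence (\<lambda>y. \<psi> y *\<^sub>R Y y) x = 0" if "R < norm x" for x
    by (rule divergence_outside_support[OF _ that]) (simp add: R)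
  then show ?thesis
    by (rule that[OF continuous_divergence[OF continuous_frechet_scaleR[OF test_function_smooth[OF \<psi>] Y]] _ R])
qed

lemma integrable_test_divergence:
  fixes Y :: "real^'n \<Rightarrow> real^'n"
  assumes "smooth Y" "test_function \<psi>" "continuous_on UNIV f"
  shows "integrable lborel (\<lambda>x. f x * divergence (\<lambda>y. \<psi> y *\<^sub>R Y y) x)"
proof -
  obtain R where "continuous_on UNIV (divergence (\<lambda>y. \<psi> y *\<^sub>R Y y))"
    "\<And>x. R < norm x \<Longrightarrow> divergence (\<lambda>y. \<psi> y *\<^sub>R Y y) x = 0" "\<And>x. R < norm x \<Longrightarrow> \<psi> x = 0"
    by (rule test_divergence_support[OF assms(1,2)]) (rule that)
  then show ?thesis
    using assms(3) by (intro integrable_compact_support[of _ R] continuous_intros) auto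
qed

lemma integrable_test_L1_loc:
  assumes "test_function \<psi>" "h \<in> L1_loc"
  shows "integrable lborel (\<lambda>x. h x * \<psi> x)"
proof -
  obtain R where "\<And>x. R < norm x \<Longrightarrow> \<psi> x = 0"
    using test_function_support[OF assms(1)] by blast
  then show ?thesis
    using L1_loc_mult_continuous[OF assms(2) smooth_continuous[OF test_function_smooth[OF assms(1)]]]
    by (intro L1_loc_integrable[of _ R]) auto
qed

lemma has_weak_deriv_const:
  fixes Y :: "real^'n \<Rightarrow> real^'n"
  assumes Y: "smooth Y"
  shows "has_weak_deriv Y (\<lambda>x. c) (\<lambda>x. 0)"
  unfolding has_weak_deriv_def
proof (intro conjI allI impI)
  show "(\<lambda>x. 0) \<in> L1_loc" by (simp add: L1_loc_def set_integrable_def)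
  fix \<psi> :: "real^'n \<Rightarrow> real" assume \<psi>: "test_function \<psi>"
  obtain R where R: "\<And>x. R < norm x \<Longrightarrow> \<psi> x = 0"
    using test_function_support[OF \<psi>] by blast
  have "((\<lambda>y. \<psi> y *\<^sub>R Y y) has_derivative (\<lambda>v. \<psi> x *\<^sub>R frechet_derivative Y (at x) v
      + frechet_derivative \<psi> (at x) v *\<^sub>R Y x)) (at x)" for x
    by (intro has_derivative_scaleR smooth_has_derivative Y test_function_smooth \<psi>)
  then have "(LINT x|lborel. divergence (\<lambda>y. \<psi> y *\<^sub>R Y y) x) = 0"
    using R by (intro integral_divergence_eq_0[of _ R] continuous_frechet_scaleR Y test_function_smooth \<psi>)
      (auto simp: differentiable_def)
  then show "(LINT x|lborel. 0 * \<psi> x) = - (LINT x|lborel. c * divergence (\<lambda>y. \<psi> y *\<^sub>R Y y) x)"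
    by simp
qed

lemma has_weak_deriv_cmult:
  assumes "has_weak_deriv Y f h"
  shows "has_weak_deriv Y (\<lambda>x. c * f x) (\<lambda>x. c * h x)"
proof -
  have "(\<lambda>x. h x * c) \<in> L1_loc"
    using assms by (intro L1_loc_mult_continuous) (auto simp: has_weak_deriv_def)
  then have "(\<lambda>x. c * h x) \<in> L1_loc" by (simp add: mult.commute)
  with assms show ?thesis by (simp add: has_weak_deriv_def mult.assoc)
qed

lemma has_weak_deriv_add:
  fixes Y :: "real^'n \<Rightarrow> real^'n"
  assumes Y: "smooth Y" and f: "continuous_on UNIV f" and g: "continuous_on UNIV g"
    and fh: "has_weak_deriv Y f h" and gk: "has_weak_deriv Y g k"
  shows "has_weak_deriv Y (\<lambda>x. f x + g x) (\<lambda>x. h x + k x)"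
proof -
  have hk: "h \<in> L1_loc" "k \<in> L1_loc" using fh gk by (auto simp: has_weak_deriv_def)
  then have "(\<lambda>x. h x + k x) \<in> L1_loc" by (auto simp: L1_loc_def intro!: set_integral_add)
  moreover have "(LINT x|lborel. (h x + k x) * \<psi> x)
      = - (LINT x|lborel. (f x + g x) * divergence (\<lambda>y. \<psi> y *\<^sub>R Y y) x)" if \<psi>: "test_function \<psi>" for \<psi>
    using fh gk \<psi> hk integrable_test_divergence[OF Y \<psi>] f g integrable_test_L1_loc[OF \<psi>]
    by (simp add: has_weak_deriv_def distrib_right)
  ultimately show ?thesis by (simp add: has_weak_deriv_def)
qed

lemma has_weak_deriv_power:
  fixes Y :: "real^'n \<Rightarrow> real^'n"
  assumes Y: "smooth Y" and f: "continuous_on UNIV f" and fh: "has_weak_deriv Y f h"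
  shows "has_weak_deriv Y (\<lambda>x. f x ^ n) (\<lambda>x. h x * (real n * f x ^ (n - 1)))"
proof (induction n)
  case 0
  show ?case using has_weak_deriv_const[OF Y, of 1] by simp
next
  case (Suc n)
  have "has_weak_deriv Y (\<lambda>x. f x ^ n * f x) (\<lambda>x. h x * (real n * f x ^ (n - 1)) * f x + h x * f x ^ n)"
    by (intro has_weak_deriv_mult Y f fh Suc continuous_intros)
  \<comment> \<open>The case split is due to \<open>n - 1\<close>, which truncates at
    \<open>n = 0\<close>; there the factor \<open>real n\<close> vanishes.\<close>
  moreover have "h x * (real n * f x ^ (n - 1)) * f x + h x * f x ^ n = h x * (real (Suc n) * f x ^ (Suc n - 1))" for x
    by (cases n) (simp_all add: algebra_simps)
  ultimately show ?case by (simp add: mult.commute)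
qed

text \<open>The strict bound \<open>k < m\<close> makes \<open>exp_partial m\<close> the derivative
  of \<open>exp_partial (Suc m)\<close>, starting from the zero polynomial.\<close>

definition exp_partial :: "nat \<Rightarrow> real \<Rightarrow> real" where
  "exp_partial m s = (\<Sum>k<m. inverse (fact k) * s ^ k)"

lemma exp_partial_tendsto: "(\<lambda>m. exp_partial m s) \<longlonglongrightarrow> exp s"
  using exp_converges[of s] by (simp add: sums_def exp_partial_def)

lemma exp_partial_bound: "\<bar>exp_partial m s\<bar> \<le> exp \<bar>s\<bar>"
proof -
  have "\<bar>exp_partial m s\<bar> \<le> (\<Sum>k<m. \<bar>s\<bar> ^ k /\<^sub>R fact k)"
    unfolding exp_partial_def by (rule order_trans[OF sum_abs]) (simp add: abs_mult power_abs)
  also have "\<dots> \<le> exp \<bar>s\<bar>"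
    using sum_le_suminf[OF sums_summable[OF exp_converges[of "\<bar>s\<bar>"]], of "{..<m}"]
      sums_unique[OF exp_converges[of "\<bar>s\<bar>"]] by simp
  finally show ?thesis .
qed

lemma exp_partial_continuous: "continuous_on UNIV f \<Longrightarrow> continuous_on UNIV (\<lambda>x. exp_partial m (f x))"
  unfolding exp_partial_def by (intro continuous_intros)

lemma has_weak_deriv_exp_partial:
  fixes Y :: "real^'n \<Rightarrow> real^'n"
  assumes Y: "smooth Y" and f: "continuous_on UNIV f" and fh: "has_weak_deriv Y f h"
  shows "has_weak_deriv Y (\<lambda>x. exp_partial (Suc m) (f x)) (\<lambda>x. h x * exp_partial m (f x))"
proof (induction m)
  case 0
  show ?case using has_weak_deriv_const[OF Y, of 1] by (simp add: exp_partial_def)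
next
  case (Suc m)
  have "has_weak_deriv Y (\<lambda>x. exp_partial (Suc m) (f x) + inverse (fact (Suc m)) * f x ^ Suc m)
      (\<lambda>x. h x * exp_partial m (f x) + inverse (fact (Suc m)) * (h x * (real (Suc m) * f x ^ (Suc m - 1))))"
    by (intro has_weak_deriv_add Y Suc has_weak_deriv_cmult has_weak_deriv_power f fh
        exp_partial_continuous continuous_intros)
  moreover have "h x * exp_partial m (f x) + inverse (fact (Suc m)) * (h x * (real (Suc m) * f x ^ (Suc m - 1)))
      = h x * exp_partial (Suc m) (f x)" for x
  proof -
    have "inverse (fact (Suc m)) * real (Suc m) = inverse (fact m)"
      by (simp add: fact_Suc del: of_nat_Suc)
    moreover have "h x * exp_partial m (f x) + inverse (fact (Suc m)) * (h x * (real (Suc m) * f x ^ (Suc m - 1)))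
        = h x * exp_partial m (f x) + (inverse (fact (Suc m)) * real (Suc m)) * (h x * f x ^ m)"
      by (simp only: mult_ac diff_Suc_1)
    ultimately show ?thesis by (simp add: exp_partial_def algebra_simps)
  qed
  ultimately show ?case by (simp add: exp_partial_def[of "Suc (Suc m)"] exp_partial_def[of "Suc m"])
qed

text \<open>The limit is taken inside the tested identity for the partial sums. They are all
  dominated by \<open>exp \<bar>f x\<bar>\<close>, which is continuous and hence integrable against
  \<open>h * \<psi>\<close> and against the compactly supported divergence.\<close>

lemma has_weak_deriv_exp:
  fixes Y :: "real^'n \<Rightarrow> real^'n"
  assumes Y: "smooth Y" and f: "continuous_on UNIV f" and fh: "has_weak_deriv Y f h"
  shows "has_weak_deriv Y (\<lambda>x. exp (f x)) (\<lambda>x. h x * exp (f x))"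
  unfolding has_weak_deriv_def
proof (intro conjI allI impI)
  have h: "h \<in> L1_loc" using fh by (simp add: has_weak_deriv_def)
  then show "(\<lambda>x. h x * exp (f x)) \<in> L1_loc"
    by (intro L1_loc_mult_continuous continuous_intros f)
  have [measurable]: "f \<in> borel_measurable borel" "h \<in> borel_measurable borel"
    using f h by (auto simp: L1_loc_def borel_measurable_continuous_onI)
  have [measurable]: "exp_partial m \<in> borel_measurable borel" for m
    unfolding exp_partial_def by measurable
  fix \<psi> :: "real^'n \<Rightarrow> real" assume \<psi>: "test_function \<psi>"
  have [measurable]: "\<psi> \<in> borel_measurable borel"
    using smooth_continuous[OF test_function_smooth[OF \<psi>]] by (rule borel_measurable_continuous_onI)
  let ?D = "divergence (\<lambda>y. \<psi> y *\<^sub>R Y y)"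
  have [measurable]: "?D \<in> borel_measurable borel"
    by (rule test_divergence_support[OF Y \<psi>]) (rule borel_measurable_continuous_onI)
  have 1: "(\<lambda>m. LINT x|lborel. h x * exp_partial m (f x) * \<psi> x) \<longlonglongrightarrow> (LINT x|lborel. h x * exp (f x) * \<psi> x)"
  proof (rule integral_dominated_convergence)
    have "(\<lambda>x. h x * exp \<bar>f x\<bar>) \<in> L1_loc" by (intro L1_loc_mult_continuous h continuous_intros f)
    then show "integrable lborel (\<lambda>x. \<bar>h x * exp \<bar>f x\<bar> * \<psi> x\<bar>)"
      by (intro integrable_abs integrable_test_L1_loc \<psi>)
    show "AE x in lborel. norm (h x * exp_partial m (f x) * \<psi> x) \<le> \<bar>h x * exp \<bar>f x\<bar> * \<psi> x\<bar>" for m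
      using exp_partial_bound by (auto simp: abs_mult intro!: mult_right_mono mult_left_mono)
  qed (auto intro!: tendsto_intros exp_partial_tendsto)
  have 2: "(\<lambda>m. LINT x|lborel. exp_partial (Suc m) (f x) * ?D x) \<longlonglongrightarrow> (LINT x|lborel. exp (f x) * ?D x)"
  proof (rule integral_dominated_convergence)
    show "integrable lborel (\<lambda>x. \<bar>exp \<bar>f x\<bar> * ?D x\<bar>)"
      by (intro integrable_abs integrable_test_divergence Y \<psi> continuous_intros f)
    show "AE x in lborel. norm (exp_partial (Suc m) (f x) * ?D x) \<le> \<bar>exp \<bar>f x\<bar> * ?D x\<bar>" for m
      using exp_partial_bound by (auto simp: abs_mult intro!: mult_right_mono)
  qed (auto intro!: tendsto_intros LIMSEQ_Suc exp_partial_tendsto)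
  have "(LINT x|lborel. h x * exp_partial m (f x) * \<psi> x)
      = - (LINT x|lborel. exp_partial (Suc m) (f x) * ?D x)" for m
    using has_weak_deriv_exp_partial[OF Y f fh, of m] \<psi> by (simp add: has_weak_deriv_def)
  with tendsto_minus[OF 2]
  have "(\<lambda>m. LINT x|lborel. h x * exp_partial m (f x) * \<psi> x) \<longlonglongrightarrow> - (LINT x|lborel. exp (f x) * ?D x)"
    by simp
  with 1 show "(LINT x|lborel. h x * exp (f x) * \<psi> x) = - (LINT x|lborel. exp (f x) * ?D x)"
    by (rule LIMSEQ_unique)
qed

section \<open>Entropy duality and the Herbst argument\<close>

lemma (in prob_space) integrable_bounded:
  fixes u :: "'a \<Rightarrow> real"
  assumes "u \<in> borel_measurable M" "\<And>x. \<bar>u x\<bar> \<le> B"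
  shows "integrable M u"
  using assms by (intro integrable_const_bound[of _ B]) auto

text \<open>Young's inequality for the convex conjugates \<open>x ln x - x\<close> and
  \<open>exp y\<close>, read off from \<open>1 + s \<le> exp s\<close> at
  \<open>s = y - ln x\<close>.\<close>

lemma young_exp:
  fixes x y :: real
  assumes "0 \<le> x"
  shows "x * y \<le> x * ln x - x + exp y"
proof (cases "x = 0")
  case False
  then have x: "0 < x" using assms by simp
  have "1 + (y - ln x) \<le> exp (y - ln x)" by (rule exp_ge_add_one_self)
  then have "x * (1 + (y - ln x)) \<le> x * exp (y - ln x)" using x by (intro mult_left_mono) auto
  also have "\<dots> = exp y" using x by (simp add: exp_diff)
  finally show ?thesis by (simp add: algebra_simps)
qed simp

text \<open>One half of the Gibbs variational principle for entropy. The boundedness assumptions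
  make every integral finite, so the argument is pointwise Young followed by integration.\<close>

lemma (in prob_space) entropy_duality:
  fixes u \<phi> :: "'a \<Rightarrow> real"
  assumes u[measurable]: "u \<in> borel_measurable M" and u0: "\<And>x. 0 \<le> u x" and uB: "\<And>x. u x \<le> B"
    and \<phi>[measurable]: "\<phi> \<in> borel_measurable M" and \<phi>B: "\<And>x. \<bar>\<phi> x\<bar> \<le> C"
  shows "integrable M (\<lambda>x. u x * ln (u x / expectation u))"
    and "expectation (\<lambda>x. u x * \<phi> x)
      \<le> expectation (\<lambda>x. u x * ln (u x / expectation u)) + expectation u * ln (expectation (\<lambda>x. exp (\<phi> x)))"
proof -
  let ?E = "expectation u" and ?Z = "expectation (\<lambda>x. exp (\<phi> x))"
  let ?h = "\<lambda>x. u x * ln (u x / ?E)"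
  have iu: "integrable M u" using u0 uB by (intro integrable_bounded[of _ B]) (auto simp: abs_of_nonneg)
  have e\<phi>: "exp (\<phi> x) \<le> exp C" "exp (- C) \<le> exp (\<phi> x)" for x using \<phi>B[of x] by auto
  then have ie: "integrable M (\<lambda>x. exp (\<phi> x))" by (intro integrable_bounded[of _ "exp C"]) auto
  have "exp (- C) = expectation (\<lambda>x. exp (- C))" by (simp add: prob_space)
  also have "\<dots> \<le> ?Z" using ie e\<phi> by (intro integral_mono) auto
  finally have Z: "0 < ?Z" using exp_gt_zero[of "- C"] by linarith
  have "\<bar>u x * \<phi> x\<bar> \<le> B * C" for x
    using u0[of x] uB[of x] \<phi>B[of x] by (auto simp: abs_mult intro!: mult_mono)
  then have iu\<phi>: "integrable M (\<lambda>x. u x * \<phi> x)" by (intro integrable_bounded[of _ "B * C"]) auto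
  have E0: "0 \<le> ?E" using u0 by simp
  show ih: "integrable M ?h"
  proof (cases "?E = 0")
    case False
    with E0 have E: "0 < ?E" by simp
    have B0: "0 \<le> B" using u0 uB by (meson order_trans)
    have "\<bar>?h x\<bar> \<le> ?E + B * (B / ?E)" for x
    proof (cases "u x = 0")
      case False
      then have x: "0 < u x" using u0[of x] by simp
      have "ln (u x / ?E) \<le> u x / ?E" using x E by (intro ln_bound) auto
      also have "\<dots> \<le> B / ?E" using uB E by (intro divide_right_mono) auto
      finally have "u x * ln (u x / ?E) \<le> u x * (B / ?E)" using x by (intro mult_left_mono) auto
      also have "\<dots> \<le> B * (B / ?E)" using uB E B0 by (intro mult_right_mono) auto
      finally have 1: "?h x \<le> B * (B / ?E)" .
      \<comment> \<open>The negative part is bounded because \<open>s * ln (E / s)\<close> is at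
        most \<open>E\<close> for positive \<open>s\<close>.\<close>
      have "ln (?E / u x) \<le> ?E / u x" using x E by (intro ln_bound) auto
      then have "u x * ln (?E / u x) \<le> u x * (?E / u x)" using x by (intro mult_left_mono) auto
      then have "- ?h x \<le> ?E" using x E by (simp add: ln_div algebra_simps)
      moreover have "0 \<le> B * (B / ?E)" using B0 E by simp
      ultimately show ?thesis using 1 E by (intro abs_leI) linarith+
    qed (use E B0 in simp)
    then show ?thesis by (intro integrable_bounded) auto
  qed simp
  show "expectation (\<lambda>x. u x * \<phi> x) \<le> expectation ?h + ?E * ln ?Z"
  proof (cases "?E = 0")
    case True
    then have "AE x in M. u x = 0"
      using iu u0 by (simp add: integral_nonneg_eq_0_iff_AE)
    then have "AE x in M. u x * \<phi> x = 0" by (elim eventually_mono) simp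
    then have "expectation (\<lambda>x. u x * \<phi> x) = 0" by (intro integral_eq_zero_AE)
    then show ?thesis by (simp add: True)
  next
    case False
    with E0 have E: "0 < ?E" by simp
    have "u x * \<phi> x \<le> ?h x - u x + ?E / ?Z * exp (\<phi> x) + ln ?Z * u x" for x
    proof -
      \<comment> \<open>Both arguments are normalised: \<open>u / ?E\<close> has mean 1, and so has
        \<open>exp (\<phi> - ln ?Z)\<close>. Hence the two linear terms of Young's inequality cancel
        after integration.\<close>
      have "?E * (u x / ?E * (\<phi> x - ln ?Z)) \<le> ?E * (u x / ?E * ln (u x / ?E) - u x / ?E + exp (\<phi> x - ln ?Z))"
        using E u0[of x] by (intro mult_left_mono young_exp) auto
      then show ?thesis using E Z by (simp add: algebra_simps exp_diff)
    qed
    then have "expectation (\<lambda>x. u x * \<phi> x) \<le> expectation (\<lambda>x. ?h x - u x + ?E / ?Z * exp (\<phi> x) + ln ?Z * u x)"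
      using iu ie iu\<phi> ih by (intro integral_mono) auto
    also have "\<dots> = expectation ?h - ?E + ?E / ?Z * ?Z + ln ?Z * ?E"
      using iu ie iu\<phi> ih by simp
    finally show ?thesis using Z by (simp add: mult.commute)
  qed
qed

text \<open>
  Testing the entropy of \<open>w powr q\<close> against \<open>K\<close> times the indicator of \<open>{w > m}\<close>, a set so small that
  the logarithmic moment of the test function is at most \<open>1\<close>, absorbs the linear term.
\<close>

lemma (in prob_space) expectation_bound_of_entropy_bound:
  fixes w v :: "'a \<Rightarrow> real"
  assumes w[measurable]: "w \<in> borel_measurable M" and w0: "\<And>x. 0 \<le> w x" and wN: "\<And>x. w x \<le> N"
    and v[measurable]: "v \<in> borel_measurable M" and wv: "\<And>x. w x \<le> v x"
    and q: "1 \<le> q" and c: "0 \<le> c" and m: "0 \<le> m"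
    and small: "prob {x \<in> space M. m < v x} * exp (2 + c) \<le> 1"
    and ent: "expectation (\<lambda>x. w x powr q * ln (w x powr q / expectation (\<lambda>x. w x powr q))) \<le> c * expectation w"
  shows "expectation w \<le> 1 + (2 + c) * m powr q + c"
proof -
  define A where "A = {x \<in> space M. m < v x}"
  let ?G = "\<lambda>x. w x powr q"
  \<comment> \<open>Of the height \<open>2 + c\<close>, one copy of \<open>expectation ?G\<close>
    pays for the logarithmic moment and \<open>c\<close> copies pay for
    \<open>c * expectation w\<close>, since \<open>w \<le> 1 + ?G\<close>. The one copy left over
    gets bounded.\<close>
  let ?\<phi> = "\<lambda>x. (2 + c) * indicator A x"
  have A[measurable]: "A \<in> events" unfolding A_def by measurable
  have small: "prob A * exp (2 + c) \<le> 1" using small by (simp add: A_def)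
  have G: "0 \<le> ?G x" "?G x \<le> N powr q" for x using w0 wN q by (auto intro!: powr_mono2)
  have iG: "integrable M ?G" using G by (intro integrable_bounded[of _ "N powr q"]) auto
  have iw: "integrable M w" using w0 wN by (intro integrable_bounded[of _ N]) (auto simp: abs_of_nonneg)
  have iA: "integrable M (\<lambda>x. indicator A x :: real)"
    using A by (intro integrable_bounded[of _ 1]) (auto simp: indicator_def)
  have "(\<lambda>x. exp (?\<phi> x)) = (\<lambda>x. 1 + (exp (2 + c) - 1) * indicator A x)"
    by (auto simp: indicator_def)
  then have Z: "expectation (\<lambda>x. exp (?\<phi> x)) = 1 + (exp (2 + c) - 1) * prob A"
    using iA A by (simp add: prob_space Int_absorb2[OF sets.sets_into_space])
  also have "\<dots> \<le> 2" using small by (simp add: algebra_simps measure_nonneg add_increasing2)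
  also have "\<dots> \<le> exp 1" using exp_ge_add_one_self[of 1] by simp
  finally have "expectation (\<lambda>x. exp (?\<phi> x)) \<le> exp 1" .
  moreover have "0 < expectation (\<lambda>x. exp (?\<phi> x))"
    unfolding Z using c by (intro add_pos_nonneg mult_nonneg_nonneg) auto
  ultimately have "ln (expectation (\<lambda>x. exp (?\<phi> x))) \<le> 1"
    using ln_le_cancel_iff[of _ "exp 1"] by simp
  then have ln1: "expectation ?G * ln (expectation (\<lambda>x. exp (?\<phi> x))) \<le> expectation ?G"
    using mult_left_mono[of _ 1 "expectation ?G"] G by simp
  have "expectation ?G - m powr q = expectation (\<lambda>x. ?G x - m powr q)"
    using iG by (simp add: prob_space)
  also have "\<dots> \<le> expectation (\<lambda>x. ?G x * indicator A x)"
  proof (rule integral_mono)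
    show "integrable M (\<lambda>x. ?G x * indicator A x)"
      using G by (intro integrable_bounded[of _ "N powr q"]) (auto simp: indicator_def)
    show "?G x - m powr q \<le> ?G x * indicator A x" if "x \<in> space M" for x
    proof (cases "m < v x")
      case False
      then have "w x \<le> m" using wv[of x] by simp
      then show ?thesis using w0[of x] q False by (simp add: A_def powr_mono2)
    qed (use that in \<open>simp add: A_def\<close>)
  qed (use iG in simp)
  finally have "(2 + c) * (expectation ?G - m powr q) \<le> (2 + c) * expectation (\<lambda>x. ?G x * indicator A x)"
    using c by (intro mult_left_mono) auto
  also have "\<dots> = expectation (\<lambda>x. ?G x * ?\<phi> x)"
    by (subst integral_mult_right_zero[symmetric]) (simp add: mult_ac)
  also have "\<dots> \<le> expectation (\<lambda>x. ?G x * ln (?G x / expectation ?G)) + expectation ?G * ln (expectation (\<lambda>x. exp (?\<phi> x)))"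
    using G c by (intro entropy_duality[of _ "N powr q" _ "2 + c"]) (auto simp: indicator_def)
  also have "\<dots> \<le> c * expectation w + expectation ?G" using ent ln1 by simp
  finally have 1: "(2 + c) * (expectation ?G - m powr q) \<le> c * expectation w + expectation ?G" .
  have "w x \<le> 1 + ?G x" for x
  proof (cases "w x \<le> 1")
    case False
    then have "w x powr 1 \<le> w x powr q" using q by (intro powr_mono) auto
    with False show ?thesis by simp
  qed (use G[of x] in linarith)
  then have "expectation w \<le> expectation (\<lambda>x. 1 + ?G x)" using iw iG by (intro integral_mono) auto
  then have 2: "expectation w \<le> 1 + expectation ?G" using iG by (simp add: prob_space)
  then have "c * expectation w \<le> c * (1 + expectation ?G)" using c by (intro mult_left_mono)
  with 1 have "expectation ?G \<le> (2 + c) * m powr q + c" by (simp add: algebra_simps)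
  with 2 show ?thesis by simp
qed

text \<open>
  The Herbst argument in discrete form: the entropy inequality bounds the tilted mean of \<open>w\<close> by
  \<open>ln H(t) / t\<close>, and duality against \<open>(t / 2) w\<close> turns this into a comparison of \<open>ln H(t)\<close> with
  \<open>ln H(t / 2)\<close>, where \<open>H(t)\<close> is the exponential moment.
\<close>

lemma (in prob_space) ln_exp_moment_halving:
  fixes w :: "'a \<Rightarrow> real"
  assumes w[measurable]: "w \<in> borel_measurable M" and w0: "\<And>x. 0 \<le> w x" and wN: "\<And>x. w x \<le> N"
    and t: "0 < t" and d: "0 \<le> d" "d \<le> 1 / 4"
    and ent: "expectation (\<lambda>x. exp (t * w x) * ln (exp (t * w x) / expectation (\<lambda>x. exp (t * w x))))
      \<le> d * t * expectation (\<lambda>x. w x * exp (t * w x))"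
  shows "ln (expectation (\<lambda>x. exp (t * w x))) \<le> 2 * exp (2 * d) * ln (expectation (\<lambda>x. exp (t / 2 * w x)))"
proof -
  define H where "H s = expectation (\<lambda>x. exp (s * w x))" for s
  define A where "A = expectation (\<lambda>x. w x * exp (t * w x))"
  have le: "0 \<le> s * w x" "s * w x \<le> s * N" if "0 \<le> s" for s x
    using w0 wN that by (auto intro: mult_left_mono)
  have ie: "integrable M (\<lambda>x. exp (s * w x))" if "0 \<le> s" for s
    using le[OF that] by (intro integrable_bounded[of _ "exp (s * N)"]) auto
  have H1: "1 \<le> H s" if "0 \<le> s" for s
  proof -
    have "expectation (\<lambda>x. 1) \<le> H s"
      unfolding H_def using ie[OF that] le[OF that] by (intro integral_mono) auto
    then show ?thesis by (simp add: prob_space)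
  qed
  have H: "1 \<le> H t" "1 \<le> H (t / 2)" using H1 t by auto
  have iA: "integrable M (\<lambda>x. w x * exp (t * w x))"
    using w0 wN le[of t] t by (intro integrable_bounded[of _ "N * exp (t * N)"])
      (auto simp: abs_mult abs_of_nonneg intro!: mult_mono order_trans[OF w0 wN])
  let ?h = "\<lambda>x. exp (t * w x) * ln (exp (t * w x) / H t)"
  have "?h x = t * (w x * exp (t * w x)) - ln (H t) * exp (t * w x)" for x
    using H by (simp add: ln_div algebra_simps)
  then have ent_eq: "expectation ?h = t * A - ln (H t) * H t"
    using iA ie[of t] t by (simp add: A_def H_def)
  have "expectation (\<lambda>x. exp (t * w x) * (t / 2 * w x)) \<le> expectation ?h + H t * ln (H (t / 2))"
    unfolding H_def
    using t le[of t] le[of "t / 2"] by (intro entropy_duality[of _ "exp (t * N)" _ "t / 2 * N"]) auto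
  moreover have "expectation (\<lambda>x. exp (t * w x) * (t / 2 * w x)) = t / 2 * A"
    unfolding A_def by (subst integral_mult_right_zero[symmetric]) (simp add: mult_ac)
  ultimately have "t / 2 * A \<le> t * A - ln (H t) * H t + H t * ln (H (t / 2))" by (simp only: ent_eq)
  then have dual: "ln (H t) * H t \<le> t / 2 * A + H t * ln (H (t / 2))" by (simp add: field_simps)
  have "t * A - ln (H t) * H t \<le> d * t * A"
    using ent by (simp add: ent_eq[symmetric]) (simp add: H_def A_def)
  then have "(1 - d) * (t * A) \<le> ln (H t) * H t" by (simp add: algebra_simps)
  have L0: "0 \<le> ln (H t)" "0 \<le> ln (H (t / 2))" using H by auto
  \<comment> \<open>The factor \<open>2 * (1 - d)\<close> turns \<open>t / 2 * A\<close> into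
    \<open>(1 - d) * (t * A)\<close>, the quantity bounded by the entropy hypothesis, so the tilted
    mean \<open>A\<close> is eliminated.\<close>
  have "2 * (1 - d) * (ln (H t) * H t) \<le> 2 * (1 - d) * (t / 2 * A + H t * ln (H (t / 2)))"
    using dual d by (intro mult_left_mono) auto
  also have "\<dots> = (1 - d) * (t * A) + 2 * (1 - d) * (H t * ln (H (t / 2)))" by (simp add: algebra_simps)
  also have "\<dots> \<le> ln (H t) * H t + 2 * (1 - d) * (H t * ln (H (t / 2)))"
    using \<open>(1 - d) * (t * A) \<le> ln (H t) * H t\<close> by simp
  finally have "H t * ((1 - 2 * d) * ln (H t)) \<le> H t * (2 * (1 - d) * ln (H (t / 2)))"
    by (simp add: algebra_simps)
  then have 1: "(1 - 2 * d) * ln (H t) \<le> 2 * (1 - d) * ln (H (t / 2))" using H by simp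
  \<comment> \<open>From \<open>d \<le> 1 / 4\<close> the quotient
    \<open>(1 - d) / (1 - 2 * d)\<close> is at most \<open>1 + 2 * d\<close>. Passing to
    \<open>exp (2 * d)\<close> lets the factors of successive halvings combine by adding
    exponents.\<close>
  have "d * (4 * d) \<le> d * 1" using d by (intro mult_left_mono) auto
  then have "1 - d \<le> (1 - 2 * d) * (1 + 2 * d)" by (simp add: algebra_simps)
  then have "2 * (1 - d) * ln (H (t / 2)) \<le> 2 * ((1 - 2 * d) * (1 + 2 * d)) * ln (H (t / 2))"
    using L0 by (intro mult_right_mono) auto
  with 1 have "(1 - 2 * d) * ln (H t) \<le> (1 - 2 * d) * (2 * (1 + 2 * d) * ln (H (t / 2)))"
    by (simp add: algebra_simps)
  then have "ln (H t) \<le> 2 * (1 + 2 * d) * ln (H (t / 2))" using d by simp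
  also have "\<dots> \<le> 2 * exp (2 * d) * ln (H (t / 2))"
    using L0 by (intro mult_right_mono mult_left_mono exp_ge_add_one_self) auto
  finally show ?thesis by (simp add: H_def)
qed

text \<open>At \<open>t = T / 2 ^ n\<close> the error \<open>k * t powr p\<close> is at most
  \<open>r ^ n / 4\<close> with \<open>r = 2 powr - p\<close>. The halving factors thus multiply to
  at most \<open>2 ^ n * exp (1 / (2 * (1 - r)))\<close>, while
  \<open>2 ^ n * ln H(T / 2 ^ n)\<close> is asymptotically at most
  \<open>T * expectation w\<close>.\<close>

lemma (in prob_space) exp_moment_bound:
  fixes w :: "'a \<Rightarrow> real"
  assumes w[measurable]: "w \<in> borel_measurable M" and w0: "\<And>x. 0 \<le> w x" and wN: "\<And>x. w x \<le> N"
    and k: "0 \<le> k" and p: "0 < p" and T: "0 < T" "k * T powr p \<le> 1 / 4"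
    and ent: "\<And>t. 0 < t \<Longrightarrow> t \<le> T \<Longrightarrow>
      expectation (\<lambda>x. exp (t * w x) * ln (exp (t * w x) / expectation (\<lambda>x. exp (t * w x))))
      \<le> k * t powr p * t * expectation (\<lambda>x. w x * exp (t * w x))"
  shows "expectation (\<lambda>x. exp (T * w x)) \<le> exp (exp (1 / (2 * (1 - 2 powr - p))) * T * expectation w)"
proof -
  define H where "H s = expectation (\<lambda>x. exp (s * w x))" for s
  define r where "r = (2::real) powr - p"
  have r: "0 < r" "r < 1" using p by (auto simp: r_def powr_less_one)
  have N0: "0 \<le> N" using w0 wN by (meson order_trans)
  have le: "0 \<le> s * w x" "s * w x \<le> s * N" if "0 \<le> s" for s x
    using w0 wN that by (auto intro: mult_left_mono)
  have ie: "integrable M (\<lambda>x. exp (s * w x))" if "0 \<le> s" for s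
    using le[OF that] by (intro integrable_bounded[of _ "exp (s * N)"]) auto
  have iw: "integrable M w" using w0 wN by (intro integrable_bounded[of _ N]) (auto simp: abs_of_nonneg)
  have H1: "1 \<le> H s" if "0 \<le> s" for s
  proof -
    have "expectation (\<lambda>x. 1) \<le> H s"
      unfolding H_def using ie[OF that] le[OF that] by (intro integral_mono) auto
    then show ?thesis by (simp add: prob_space)
  qed
  \<comment> \<open>A crude linear bound at 0, in which the upper bound \<open>N\<close> of
    \<open>w\<close> appears only through \<open>exp (s * N)\<close>.\<close>
  have upper: "ln (H s) \<le> s * exp (s * N) * expectation w" if s: "0 \<le> s" for s
  proof -
    have "exp (s * w x) \<le> 1 + s * exp (s * N) * w x" for x
    proof -
      have "1 - s * w x \<le> exp (- (s * w x))" using exp_ge_add_one_self[of "- (s * w x)"] by simp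
      then have "exp (s * w x) * (1 - s * w x) \<le> exp (s * w x) * exp (- (s * w x))"
        by (intro mult_left_mono) auto
      then have "exp (s * w x) \<le> 1 + exp (s * w x) * (s * w x)"
        by (simp add: algebra_simps flip: exp_add)
      also have "exp (s * w x) * (s * w x) \<le> exp (s * N) * (s * w x)"
        using le[OF s, of x] by (intro mult_right_mono) auto
      finally show ?thesis by (simp add: mult_ac)
    qed
    then have "H s \<le> expectation (\<lambda>x. 1 + s * exp (s * N) * w x)"
      unfolding H_def using ie[OF s] iw by (intro integral_mono) auto
    also have "\<dots> = 1 + s * exp (s * N) * expectation w" using iw by (simp add: prob_space)
    finally show ?thesis using ln_add_one_self_le_self2[of "H s - 1"] H1[OF s] by simp
  qed
  let ?S = "\<lambda>n. (1 / 2) * (\<Sum>j<n. r ^ j)"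
  have iter: "ln (H T) \<le> 2 ^ n * exp (?S n) * ln (H (T / 2 ^ n))" for n
  proof (induction n)
    case (Suc n)
    let ?t = "T / 2 ^ n"
    have t: "0 < ?t" "?t \<le> T" using T by (auto simp: field_simps)
    have "r ^ n = 2 powr (- (real n * p))"
      by (simp add: r_def powr_power mult.commute)
    moreover have "(2 ^ n) powr p = 2 powr (real n * p)"
      by (simp add: powr_powr flip: powr_realpow)
    moreover have "?t powr p = T powr p / (2 ^ n) powr p"
      by (rule powr_divide)
    ultimately have "?t powr p = T powr p * r ^ n"
      by (simp only: powr_minus divide_inverse)
    then have kt: "k * ?t powr p = k * T powr p * r ^ n" by simp
    also have "\<dots> \<le> 1 / 4 * r ^ n" using T r by (intro mult_right_mono) auto
    finally have d: "k * ?t powr p \<le> 1 / 4 * r ^ n" .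
    also have "\<dots> \<le> 1 / 4" using r by (simp add: power_le_one)
    finally have "k * ?t powr p \<le> 1 / 4" .
    then have "ln (H ?t) \<le> 2 * exp (2 * (k * ?t powr p)) * ln (H (?t / 2))"
      unfolding H_def using k t ent[OF t] by (intro ln_exp_moment_halving[of w N] w w0 wN) auto
    also have "\<dots> \<le> 2 * exp (1 / 2 * r ^ n) * ln (H (?t / 2))"
      using d H1[of "?t / 2"] t by (intro mult_right_mono mult_left_mono) auto
    finally have "2 ^ n * exp (?S n) * ln (H ?t) \<le> 2 ^ n * exp (?S n) * (2 * exp (1 / 2 * r ^ n) * ln (H (?t / 2)))"
      by (intro mult_left_mono) auto
    also have "\<dots> = 2 ^ Suc n * exp (?S (Suc n)) * ln (H (T / 2 ^ Suc n))"
      by (simp add: distrib_left exp_add mult_ac)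
    finally show ?case by (rule order_trans[OF Suc])
  qed simp
  have S: "?S n \<le> 1 / (2 * (1 - r))" for n
  proof -
    have "(\<Sum>j<n. r ^ j) \<le> 1 / (1 - r)"
      using sum_le_suminf[of "\<lambda>j. r ^ j" "{..<n}"] r by (simp add: summable_geometric suminf_geometric)
    from mult_left_mono[OF this, of "1 / 2"] show ?thesis by simp
  qed
  have bound: "ln (H T) \<le> exp (1 / (2 * (1 - r))) * T * expectation w * exp (T / 2 ^ n * N)" for n
  proof -
    have m0: "0 \<le> expectation w" using w0 by simp
    have "ln (H (T / 2 ^ n)) \<le> T / 2 ^ n * exp (T / 2 ^ n * N) * expectation w"
      using T by (intro upper) auto
    then have "2 ^ n * exp (?S n) * ln (H (T / 2 ^ n)) \<le> 2 ^ n * exp (?S n) * (T / 2 ^ n * exp (T / 2 ^ n * N) * expectation w)"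
      by (intro mult_left_mono) auto
    also have "\<dots> = exp (?S n) * (T * exp (T / 2 ^ n * N) * expectation w)" by simp
    also have "\<dots> \<le> exp (1 / (2 * (1 - r))) * (T * exp (T / 2 ^ n * N) * expectation w)"
      using S[of n] T m0 by (intro mult_right_mono) auto
    finally show ?thesis using iter[of n] by (simp add: mult_ac)
  qed
  \<comment> \<open>In the limit \<open>N\<close> disappears; this is what makes the result uniform
    over the truncations.\<close>
  have "(\<lambda>n. T * inverse (2 ^ n) * N) \<longlonglongrightarrow> T * 0 * N"
    by (intro tendsto_intros LIMSEQ_inverse_realpow_zero) simp
  then have "(\<lambda>n. exp (1 / (2 * (1 - r))) * T * expectation w * exp (T / 2 ^ n * N))
      \<longlonglongrightarrow> exp (1 / (2 * (1 - r))) * T * expectation w * exp 0"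
    by (intro tendsto_intros) (simp add: divide_inverse)
  then have "ln (H T) \<le> exp (1 / (2 * (1 - r))) * T * expectation w"
    using bound LIMSEQ_le_const by fastforce
  then have "H T \<le> exp (exp (1 / (2 * (1 - r))) * T * expectation w)"
    using H1[of T] T by (simp add: ln_ge_iff flip: ln_le_cancel_iff)
  then show ?thesis by (simp add: H_def r_def)
qed

section \<open>Applying the logarithmic Sobolev inequality\<close>

text \<open>A continuous function is negative on an open set, and a nonempty open set is not
  null.\<close>

lemma AE_lborel_nonneg_continuous:
  fixes u :: "'a::euclidean_space \<Rightarrow> real"
  assumes u: "continuous_on UNIV u" and AE: "AE x in lborel. 0 \<le> u x"
  shows "0 \<le> u x"
proof (rule ccontr)
  assume x: "\<not> 0 \<le> u x"
  have o: "open {x. u x < 0}" using u by (intro open_Collect_less continuous_intros)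
  have "AE x in lborel. x \<notin> {x. u x < 0}" using AE by (elim eventually_mono) auto
  then have "{x. u x < 0} \<in> null_sets lborel"
    using o by (simp add: AE_iff_null_sets)
  then have "negligible {x. u x < 0}"
    by (simp add: negligible_iff_null_sets null_sets_completionI)
  moreover have "x \<in> {x. u x < 0}" using x by simp
  ultimately show False using open_not_negligible[OF o] by blast
qed

lemma Linf_locI:
  fixes h u :: "real^'n \<Rightarrow> real"
  assumes "h \<in> borel_measurable borel" and u: "continuous_on UNIV u"
    and AE: "AE x in lborel. \<bar>h x\<bar> \<le> u x"
  shows "h \<in> Linf_loc"
  unfolding Linf_loc_def
proof (intro CollectI conjI allI impI)
  fix K :: "(real^'n) set" assume "compact K"
  then have "bounded (u ` K)"
    using u by (intro compact_imp_bounded compact_continuous_image) (auto intro: continuous_on_subset)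
  then obtain B where B: "\<And>x. x \<in> K \<Longrightarrow> \<bar>u x\<bar> \<le> B" by (force simp: bounded_iff)
  have "AE x in lborel. x \<in> K \<longrightarrow> \<bar>h x\<bar> \<le> B"
    using AE by (elim eventually_mono) (use B in force)
  then show "\<exists>B. AE x in lborel. x \<in> K \<longrightarrow> \<bar>h x\<bar> \<le> B" by blast
qed (use assms in auto)

lemma ext_integral_eq_integral:
  assumes "integrable M h"
  shows "ext_integral M h = ereal (integral\<^sup>L M h)"
proof -
  have fin: "(\<integral>\<^sup>+x. ennreal (h x) \<partial>M) \<noteq> \<infinity>" "(\<integral>\<^sup>+x. ennreal (- h x) \<partial>M) \<noteq> \<infinity>"
    using assms by (auto simp: real_integrable_def)
  then show ?thesis
    unfolding ext_integral_def real_lebesgue_integral_def[OF assms]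
    by (cases "\<integral>\<^sup>+x. ennreal (h x) \<partial>M"; cases "\<integral>\<^sup>+x. ennreal (- h x) \<partial>M") auto
qed

section \<open>The inequality for bounded nonnegative functions\<close>

lemma has_weak_deriv_affine:
  fixes Y :: "real^'n \<Rightarrow> real^'n"
  assumes "smooth Y" "continuous_on UNIV f" "has_weak_deriv Y f h"
  shows "has_weak_deriv Y (\<lambda>x. \<alpha> * f x + \<beta>) (\<lambda>x. \<alpha> * h x)"
  using has_weak_deriv_add[OF assms(1) _ _ has_weak_deriv_cmult[OF assms(3)] has_weak_deriv_const[OF assms(1)]]
    assms(2) by (simp add: continuous_intros)

text \<open>\<open>LS\<close> with its constant exposed, so that the same \<open>c\<close> serves
  for the truncations at all levels and for their exponentials.\<close>

definition LS_const ::
  "('k::finite \<Rightarrow> real^'n \<Rightarrow> real^'n) \<Rightarrow> (real^'n) measure \<Rightarrow> real \<Rightarrow> real \<Rightarrow> bool" where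
  "LS_const X \<mu> q c \<longleftrightarrow>
     (\<forall>g\<in>class_L X. \<forall>G. has_weak_gradient X g G \<longrightarrow>
        integrable \<mu> (\<lambda>x. \<bar>g x\<bar> powr q) \<longrightarrow>
        ext_integral \<mu> (\<lambda>x. \<bar>g x\<bar> powr q * ln (\<bar>g x\<bar> powr q / (LINT y|\<mu>. \<bar>g y\<bar> powr q)))
          \<le> ereal c * enn2ereal (\<integral>\<^sup>+x. ennreal (norm (G x) powr q) \<partial>\<mu>))"

lemma LS_iff_LS_const: "LS X \<mu> q \<longleftrightarrow> (\<exists>c>0. LS_const X \<mu> q c)"
  by (simp add: LS_def LS_const_def)

text \<open>Turns the extended-valued inequality into one between ordinary integrals. The majorant
  \<open>r\<close> does double duty: \<open>\<bar>G x $ i\<bar> \<le> 1 + r x\<close> puts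
  \<open>g\<close> into the class, and integrating \<open>r\<close> makes the right-hand side
  finite.\<close>

lemma LS_bounded:
  fixes X :: "'k::finite \<Rightarrow> real^'n \<Rightarrow> real^'n" and G :: "real^'n \<Rightarrow> real^'k"
  assumes \<mu>: "prob_space \<mu>" "sets \<mu> = sets borel" "absolutely_continuous lborel \<mu>"
    and q: "1 < q" and c: "0 < c" and LS: "LS_const X \<mu> q c"
    and g: "continuous_on UNIV g" "\<And>x. 0 \<le> g x" "\<And>x. g x \<le> B"
    and G: "\<And>i. has_weak_deriv (X i) g (\<lambda>x. G x $ i)"
    and r: "continuous_on UNIV r" "\<And>x. 0 \<le> r x" "\<And>x. r x \<le> C"
    and le: "AE x in lborel. norm (G x) powr q \<le> r x"
  shows "(LINT x|\<mu>. g x powr q * ln (g x powr q / (LINT y|\<mu>. g y powr q))) \<le> c * (LINT x|\<mu>. r x)"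
proof -
  interpret prob_space \<mu> by (rule \<mu>)
  have bm: "u \<in> borel_measurable \<mu>" if "u \<in> borel_measurable borel" for u :: "real^'n \<Rightarrow> real"
    using that measurable_cong_sets[OF \<mu>(2) refl] by blast
  have bg: "g \<in> borel_measurable \<mu>" and br: "r \<in> borel_measurable \<mu>"
    using g(1) r(1) by (auto intro!: bm borel_measurable_continuous_onI)
  note [measurable] = bg br
  have ir: "integrable \<mu> r" using r by (intro integrable_bounded[of _ C]) (auto simp: abs_of_nonneg)
  have gq: "0 \<le> g x powr q" "g x powr q \<le> B powr q" for x using g q by (auto intro!: powr_mono2)
  have ig: "integrable \<mu> (\<lambda>x. g x powr q)"
    using gq by (intro integrable_bounded[of _ "B powr q"]) auto
  have "g \<in> class_L X"
    unfolding class_L_def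
  proof (intro CollectI conjI allI g(1))
    fix i
    have "(\<lambda>x. G x $ i) \<in> Linf_loc"
    proof (rule Linf_locI)
      show "(\<lambda>x. G x $ i) \<in> borel_measurable borel"
        using G by (simp add: has_weak_deriv_def L1_loc_def)
      show "continuous_on UNIV (\<lambda>x. 1 + r x)" using r by (intro continuous_intros)
      show "AE x in lborel. \<bar>G x $ i\<bar> \<le> 1 + r x"
        using le
      proof (elim eventually_mono)
        fix x assume x: "norm (G x) powr q \<le> r x"
        have "\<bar>G x $ i\<bar> \<le> norm (G x)" by (rule component_le_norm_cart)
        also have "\<dots> \<le> 1 + norm (G x) powr q"
        proof (cases "norm (G x) \<le> 1")
          case False
          then have "norm (G x) powr 1 \<le> norm (G x) powr q" using q by (intro powr_mono) auto
          then show ?thesis by simp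
        qed (simp add: add_increasing2)
        finally show "\<bar>G x $ i\<bar> \<le> 1 + r x" using x by simp
      qed
    qed
    then show "\<exists>h\<in>Linf_loc. has_weak_deriv (X i) g h" using G by blast
  qed
  then have "ext_integral \<mu> (\<lambda>x. \<bar>g x\<bar> powr q * ln (\<bar>g x\<bar> powr q / (LINT y|\<mu>. \<bar>g y\<bar> powr q)))
      \<le> ereal c * enn2ereal (\<integral>\<^sup>+x. ennreal (norm (G x) powr q) \<partial>\<mu>)"
    using LS[unfolded LS_const_def, THEN bspec, of g] G ig
    unfolding has_weak_gradient_def abs_of_nonneg[OF g(2)] by blast
  then have "ext_integral \<mu> (\<lambda>x. g x powr q * ln (g x powr q / (LINT y|\<mu>. g y powr q)))
      \<le> ereal c * enn2ereal (\<integral>\<^sup>+x. ennreal (norm (G x) powr q) \<partial>\<mu>)"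
    unfolding abs_of_nonneg[OF g(2)] .
  moreover have "integrable \<mu> (\<lambda>x. g x powr q * ln (g x powr q / (LINT y|\<mu>. g y powr q)))"
    using gq by (intro entropy_duality(1)[of _ "B powr q" "\<lambda>_. 0" 0]) auto
  moreover have "(\<integral>\<^sup>+x. ennreal (norm (G x) powr q) \<partial>\<mu>) \<le> ennreal (LINT x|\<mu>. r x)"
  proof -
    \<comment> \<open>Absolute continuity carries the gradient bound from Lebesgue measure to
      \<open>\<mu>\<close>.\<close>
    have "AE x in \<mu>. norm (G x) powr q \<le> r x"
      using absolutely_continuous_AE[OF _ \<mu>(3) le] \<mu>(2) by simp
    then have "(\<integral>\<^sup>+x. ennreal (norm (G x) powr q) \<partial>\<mu>) \<le> (\<integral>\<^sup>+x. ennreal (r x) \<partial>\<mu>)"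
      by (intro nn_integral_mono_AE) (auto elim!: eventually_mono intro!: ennreal_leI)
    then show ?thesis using nn_integral_eq_integral[OF ir] r by simp
  qed
  then have "ereal c * enn2ereal (\<integral>\<^sup>+x. ennreal (norm (G x) powr q) \<partial>\<mu>) \<le> ereal c * ereal (LINT x|\<mu>. r x)"
    using c r by (intro ereal_mult_left_mono) (auto simp: less_eq_ennreal.rep_eq enn2ereal_ennreal)
  ultimately show ?thesis using order_trans by (fastforce simp: ext_integral_eq_integral)
qed

text \<open>The truncation \<open>n (1 - exp (- v / n))\<close> of \<open>v \<ge> 0\<close> is bounded, increases to \<open>v\<close>, and inherits the
  gradient bound, since \<open>s exp (- s) \<le> 1 - exp (- s)\<close>.\<close>

definition trunc :: "real \<Rightarrow> real \<Rightarrow> real" where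
  "trunc n s = n * (1 - exp (- (s / n)))"

lemma trunc_bounds:
  assumes "0 < n" "0 \<le> s"
  shows "0 \<le> trunc n s" "trunc n s \<le> n" "trunc n s \<le> s" "exp (- (s / n)) * s \<le> trunc n s"
proof -
  let ?x = "s / n"
  show "0 \<le> trunc n s" "trunc n s \<le> n" using assms by (auto simp: trunc_def)
  have "1 - exp (- ?x) \<le> ?x" using exp_ge_add_one_self[of "- ?x"] by simp
  then have "n * (1 - exp (- ?x)) \<le> n * ?x" using assms by (intro mult_left_mono) auto
  then show "trunc n s \<le> s" using assms by (simp add: trunc_def)
  have "exp (- ?x) * (1 + ?x) \<le> exp (- ?x) * exp ?x"
    by (intro mult_left_mono exp_ge_add_one_self) auto
  then have "exp (- ?x) * ?x \<le> 1 - exp (- ?x)" by (simp add: algebra_simps flip: exp_add)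
  then have "n * (exp (- ?x) * ?x) \<le> n * (1 - exp (- ?x))" using assms by (intro mult_left_mono) auto
  then show "exp (- ?x) * s \<le> trunc n s" using assms by (simp add: trunc_def)
qed

text \<open>With \<open>h = 1 / n\<close> the truncation is a difference quotient at 0 of
  \<open>- exp (- (s * h))\<close>, whose derivative there is \<open>s\<close>.\<close>

lemma trunc_tendsto: "(\<lambda>i. trunc (real (Suc i)) s) \<longlonglongrightarrow> s"
proof -
  have "((\<lambda>h. - exp (- (s * h))) has_real_derivative s) (at 0)"
    by (auto intro!: derivative_eq_intros)
  then have "((\<lambda>h. (1 - exp (- (s * h))) / h) \<longlongrightarrow> s) (at 0)"
    by (simp add: has_field_derivative_iff)
  moreover have "filterlim (\<lambda>m. inverse (real (Suc m))) (at 0) sequentially"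
    using LIMSEQ_inverse_real_of_nat by (simp add: filterlim_at)
  ultimately have "(\<lambda>i. (1 - exp (- (s * inverse (real (Suc i))))) / inverse (real (Suc i))) \<longlonglongrightarrow> s"
    by (rule filterlim_compose)
  then show ?thesis by (simp add: trunc_def divide_inverse mult.commute)
qed

lemma trunc_continuous: "continuous_on UNIV v \<Longrightarrow> continuous_on UNIV (\<lambda>x. trunc n (v x))"
  unfolding trunc_def divide_inverse by (intro continuous_intros)

lemma has_weak_deriv_trunc:
  fixes Y :: "real^'n \<Rightarrow> real^'n"
  assumes Y: "smooth Y" and v: "continuous_on UNIV v" and vh: "has_weak_deriv Y v h" and n: "0 < n"
  shows "has_weak_deriv Y (\<lambda>x. trunc n (v x)) (\<lambda>x. exp (- (v x / n)) * h x)"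
proof -
  have "has_weak_deriv Y (\<lambda>x. (- inverse n) * v x + 0) (\<lambda>x. (- inverse n) * h x)"
    by (intro has_weak_deriv_affine Y v vh)
  then have "has_weak_deriv Y (\<lambda>x. exp ((- inverse n) * v x + 0)) (\<lambda>x. (- inverse n) * h x * exp ((- inverse n) * v x + 0))"
    by (intro has_weak_deriv_exp Y v continuous_intros)
  then have "has_weak_deriv Y (\<lambda>x. (- n) * exp ((- inverse n) * v x + 0) + n)
      (\<lambda>x. (- n) * ((- inverse n) * h x * exp ((- inverse n) * v x + 0)))"
    by (intro has_weak_deriv_affine Y v continuous_intros)
  moreover have "(- n) * exp ((- inverse n) * v x + 0) + n = trunc n (v x)"
    "(- n) * ((- inverse n) * h x * exp ((- inverse n) * v x + 0)) = exp (- (v x / n)) * h x" for x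
    using n by (simp_all add: trunc_def divide_inverse algebra_simps)
  ultimately show ?thesis by (simp only:)
qed

text \<open>Continuity from above: the tails of a real-valued function decrease to the empty set,
  without any moment assumption.\<close>

lemma prob_small_tail:
  assumes \<mu>: "prob_space \<mu>" and v: "v \<in> borel_measurable \<mu>" and e: "0 < e"
  obtains m :: real where "0 \<le> m" "measure \<mu> {x \<in> space \<mu>. m < v x} < e"
proof -
  interpret prob_space \<mu> by (rule \<mu>)
  let ?A = "\<lambda>i::nat. {x \<in> space \<mu>. real i < v x}"
  have "(\<lambda>i. prob (?A i)) \<longlonglongrightarrow> prob (\<Inter>i. ?A i)"
    using v by (intro finite_Lim_measure_decseq) (auto simp: decseq_def)
  moreover have "(\<Inter>i. ?A i) = {}"
  proof -
    have "\<exists>i. x \<notin> ?A i" for x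
      using reals_Archimedean2[of "v x"] by (auto simp: not_less intro: less_imp_le)
    then show ?thesis by blast
  qed
  ultimately have "(\<lambda>i. prob (?A i)) \<longlonglongrightarrow> 0" by simp
  then have "eventually (\<lambda>i. prob (?A i) < e) sequentially"
    using e by (rule order_tendstoD(2))
  then obtain i where "prob (?A i) < e" by (auto simp: eventually_sequentially)
  then show ?thesis using that[of "real i"] by simp
qed

theorem theorem4p5:
  fixes X :: "'k::finite \<Rightarrow> real^'n \<Rightarrow> real^'n"
    and \<mu> :: "(real^'n) measure"
    and f :: "real^'n \<Rightarrow> real"
    and F :: "real^'n \<Rightarrow> real^'k"
    and q a b :: real
  assumes "\<And>i. smooth (X i)"
    and "prob_space \<mu>" and "sets \<mu> = sets borel"
    and "absolutely_continuous lborel \<mu>"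
    and "1 < q" and "q \<le> 2"
    and "LS X \<mu> q"
    and "f \<in> class_L X" and "has_weak_gradient X f F"
    and "0 < a" and "0 < b"
    and "AE x in lborel. norm (F x) powr q \<le> a * f x + b"
  shows "\<exists>t0>0. \<forall>t::real. 0 < t \<and> t < t0 \<longrightarrow> (\<integral>\<^sup>+x. ennreal (exp (t * f x)) \<partial>\<mu>) < \<infinity>"
proof -
  note X = assms(1) and \<mu> = assms(2-4) and q = assms(5) and a = assms(10) and b = assms(11)
  interpret prob_space \<mu> by (rule \<mu>)
  obtain c where c: "0 < c" and LS: "LS_const X \<mu> q c"
    using assms(7) unfolding LS_iff_LS_const by blast
  define v where "v x = f x + b / a" for x
  have cf: "continuous_on UNIV f" using assms(8) by (simp add: class_L_def)
  have cv: "continuous_on UNIV v" unfolding v_def by (intro continuous_intros cf)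
  have av: "a * v x = a * f x + b" for x using a by (simp add: v_def field_simps)
  have F: "AE x in lborel. norm (F x) powr q \<le> a * v x" using assms(12) by (simp add: av)
  have "AE x in lborel. 0 \<le> v x"
    using F by (elim eventually_mono) (metis a order_trans powr_ge_zero zero_le_mult_iff not_le)
  then have v0: "0 \<le> v x" for x by (rule AE_lborel_nonneg_continuous[OF cv])
  have dv: "has_weak_deriv (X i) v (\<lambda>x. F x $ i)" for i
    using has_weak_deriv_affine[OF X cf, of i "\<lambda>x. F x $ i" 1 "b / a"] assms(9)
    by (simp add: has_weak_gradient_def v_def[abs_def])
  have bm: "u \<in> borel_measurable \<mu>" if "continuous_on UNIV u" for u :: "real^'n \<Rightarrow> real"
    using borel_measurable_continuous_onI[OF that] measurable_cong_sets[OF \<mu>(2) refl] by blast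

  define p where "p = q - 1"
  have p: "0 < p" using q by (simp add: p_def)
  \<comment> \<open>For \<open>g = exp (t * w / q)\<close> the \<open>q\<close>-th power of the
    gradient is at most \<open>(t / q) powr q * a * w * exp (t * w)\<close>. Writing
    \<open>t powr q = t powr p * t\<close> leaves the constant \<open>k\<close>.\<close>
  define k where "k = c * a / q powr q"
  have k: "0 < k" using a c q by (simp add: k_def)
  \<comment> \<open>\<open>T\<close> solves \<open>k * T powr p = 1 / 4\<close>, the largest error
    that the halving step admits.\<close>
  define T where "T = (1 / (4 * k)) powr (1 / p)"
  have T: "0 < T" "k * T powr p \<le> 1 / 4" using k p by (auto simp: T_def powr_powr)
  \<comment> \<open>The tail is that of \<open>v\<close>, which dominates every truncation, so
    \<open>m\<close> and hence \<open>Z\<close> are independent of \<open>n\<close>. The exponent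
    contains \<open>c * a\<close> because the entropy of \<open>w powr q\<close> will be bounded by
    \<open>c * a * expectation w\<close>.\<close>
  obtain m where m: "0 \<le> m" "prob {x \<in> space \<mu>. m < v x} < exp (- (2 + c * a))"
    using prob_small_tail[OF \<mu>(1) bm[OF cv], of "exp (- (2 + c * a))"] by auto
  have small: "prob {x \<in> space \<mu>. m < v x} * exp (2 + c * a) \<le> 1"
  proof -
    have "prob {x \<in> space \<mu>. m < v x} * exp (2 + c * a) \<le> exp (- (2 + c * a)) * exp (2 + c * a)"
      using m by (intro mult_right_mono) auto
    then show ?thesis by (simp flip: exp_add)
  qed
  define Z where "Z = exp (exp (1 / (2 * (1 - 2 powr - p))) * T * (1 + (2 + c * a) * m powr q + c * a))"

  have bound: "expectation (\<lambda>x. exp (T * trunc n (v x))) \<le> Z" if n: "0 < n" for n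
  proof -
    define w where "w x = trunc n (v x)" for x
    define W where "W x = exp (- (v x / n)) *\<^sub>R F x" for x
    have cw: "continuous_on UNIV w" unfolding w_def by (intro trunc_continuous cv)
    have w: "0 \<le> w x" "w x \<le> n" "w x \<le> v x" "exp (- (v x / n)) * v x \<le> w x" for x
      using trunc_bounds[OF n v0] by (auto simp: w_def)
    have dw: "has_weak_deriv (X i) w (\<lambda>x. W x $ i)" for i
      using has_weak_deriv_trunc[OF X cv dv n] by (simp add: w_def[abs_def] W_def)
    have W: "AE x in lborel. norm (W x) powr q \<le> a * w x"
      using F
    proof (elim eventually_mono)
      fix x assume F: "norm (F x) powr q \<le> a * v x"
      let ?e = "exp (- (v x / n))"
      \<comment> \<open>The damping factor is at most 1, so its \<open>q\<close>-th power is at most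
        the factor itself, and one such factor suffices to bring \<open>v x\<close> below
        \<open>w x\<close>.\<close>
      have "?e powr q \<le> ?e powr 1" using n v0[of x] q by (intro powr_mono') auto
      then have "?e powr q * norm (F x) powr q \<le> ?e * (a * v x)" using F by (intro mult_mono) auto
      also have "\<dots> \<le> a * w x" using a w(4)[of x] by (simp add: mult.left_commute)
      finally show "norm (W x) powr q \<le> a * w x" by (simp add: W_def powr_mult)
    qed
    \<comment> \<open>The right-hand side is linear in \<open>w\<close> while the entropy is that of
      \<open>w powr q\<close>; this imbalance is what closes the estimate of the mean.\<close>
    have "expectation (\<lambda>x. w x powr q * ln (w x powr q / expectation (\<lambda>x. w x powr q))) \<le> c * expectation (\<lambda>x. a * w x)"
      using a w by (intro LS_bounded[OF \<mu> q c LS cw w(1,2) dw _ _ _ W, of "a * n"] continuous_intros cw) auto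
    then have mean: "expectation w \<le> 1 + (2 + c * a) * m powr q + c * a"
      using q a c m
      by (intro expectation_bound_of_entropy_bound[OF bm[OF cw] w(1,2) bm[OF cv] w(3) _ _ m(1) small])
        (auto simp: mult.assoc)
    have ent: "expectation (\<lambda>x. exp (t * w x) * ln (exp (t * w x) / expectation (\<lambda>x. exp (t * w x))))
      \<le> k * t powr p * t * expectation (\<lambda>x. w x * exp (t * w x))" if t: "0 < t" "t \<le> T" for t
    proof -
      let ?g = "\<lambda>x. exp (t / q * w x)"
      let ?G = "\<lambda>x. (t / q * ?g x) *\<^sub>R W x"
      let ?r = "\<lambda>x. (t / q) powr q * a * (w x * exp (t * w x))"
      \<comment> \<open>The exponent \<open>t / q\<close> is chosen so that the entropy of the
        \<open>q\<close>-th power is the one in \<open>exp_moment_bound\<close>.\<close>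
      have gq: "?g x powr q = exp (t * w x)" for x
        using q by (simp add: powr_def)
      have tn: "t * w x \<le> t * n" for x using w t by simp
      have dg: "has_weak_deriv (X i) ?g (\<lambda>x. ?G x $ i)" for i
      proof -
        have "has_weak_deriv (X i) (\<lambda>x. t / q * w x + 0) (\<lambda>x. t / q * W x $ i)"
          by (intro has_weak_deriv_affine X cw dw)
        then have "has_weak_deriv (X i) (\<lambda>x. exp (t / q * w x + 0)) (\<lambda>x. t / q * W x $ i * exp (t / q * w x + 0))"
          by (intro has_weak_deriv_exp X cw continuous_intros)
        then show ?thesis by (simp add: mult_ac)
      qed
      have G: "AE x in lborel. norm (?G x) powr q \<le> ?r x"
        using W
      proof (elim eventually_mono)
        fix x assume W: "norm (W x) powr q \<le> a * w x"
        have "norm (?G x) = t / q * ?g x * norm (W x)" using t q by simp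
        then have "norm (?G x) powr q = (t / q) powr q * exp (t * w x) * norm (W x) powr q"
          by (simp only: powr_mult gq)
        also have "\<dots> \<le> (t / q) powr q * exp (t * w x) * (a * w x)"
          using W by (intro mult_left_mono) auto
        finally show "norm (?G x) powr q \<le> ?r x" by (simp add: mult_ac)
      qed
      have LS_exp: "expectation (\<lambda>x. ?g x powr q * ln (?g x powr q / expectation (\<lambda>x. ?g x powr q))) \<le> c * expectation ?r"
      proof (rule LS_bounded[OF \<mu> q c LS _ _ _ dg _ _ _ G])
        show "continuous_on UNIV ?g" "continuous_on UNIV ?r" by (intro continuous_intros cw)+
        show "?g x \<le> exp (t / q * n)" for x using w t q by (simp add: divide_right_mono)
        show "?r x \<le> (t / q) powr q * a * (n * exp (t * n))" for x
          using a w[of x] n tn[of x] by (intro mult_left_mono mult_mono) auto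
        show "0 \<le> ?r x" for x using a w(1)[of x] by simp
      qed simp
      have "t powr q = t powr p * t" using t by (simp add: p_def powr_diff)
      then have r_eq: "c * ((t / q) powr q * a * E) = k * t powr p * t * E" for E
        by (simp add: k_def powr_divide)
      show ?thesis using LS_exp unfolding gq integral_mult_right_zero r_eq .
    qed
    have "expectation (\<lambda>x. exp (T * w x)) \<le> exp (exp (1 / (2 * (1 - 2 powr - p))) * T * expectation w)"
      using exp_moment_bound[OF bm[OF cw] w(1,2) _ p T ent] k by simp
    also have "\<dots> \<le> Z"
      unfolding Z_def using mean T by (simp add: mult_left_mono)
    finally show ?thesis by (simp add: w_def)
  qed

  have "(\<integral>\<^sup>+x. ennreal (exp (T * v x)) \<partial>\<mu>)
      = (\<integral>\<^sup>+x. liminf (\<lambda>i. ennreal (exp (T * trunc (real (Suc i)) (v x)))) \<partial>\<mu>)"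
  proof (rule nn_integral_cong)
    fix x
    have "(\<lambda>i. ennreal (exp (T * trunc (real (Suc i)) (v x)))) \<longlonglongrightarrow> ennreal (exp (T * v x))"
      by (intro tendsto_ennrealI tendsto_intros trunc_tendsto)
    then show "ennreal (exp (T * v x)) = liminf (\<lambda>i. ennreal (exp (T * trunc (real (Suc i)) (v x))))"
      using lim_imp_Liminf[OF sequentially_bot] by metis
  qed
  also have "\<dots> \<le> liminf (\<lambda>i. \<integral>\<^sup>+x. ennreal (exp (T * trunc (real (Suc i)) (v x))) \<partial>\<mu>)"
    by (intro nn_integral_liminf measurable_compose[OF _ measurable_ennreal] bm continuous_intros trunc_continuous cv)
  also have "\<dots> \<le> ennreal Z"
  proof (rule Liminf_le)
    have "(\<integral>\<^sup>+x. ennreal (exp (T * trunc (real (Suc i)) (v x))) \<partial>\<mu>) \<le> ennreal Z" for i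
    proof -
      have "T * trunc (real (Suc i)) (v x) \<le> T * real (Suc i)" for x
        using trunc_bounds(2)[of "real (Suc i)" "v x"] v0 T by (intro mult_left_mono) auto
      then have "integrable \<mu> (\<lambda>x. exp (T * trunc (real (Suc i)) (v x)))"
        by (intro integrable_bounded[of _ "exp (T * real (Suc i))"] bm continuous_intros trunc_continuous cv) auto
      then have "(\<integral>\<^sup>+x. ennreal (exp (T * trunc (real (Suc i)) (v x))) \<partial>\<mu>)
          = ennreal (expectation (\<lambda>x. exp (T * trunc (real (Suc i)) (v x))))"
        by (intro nn_integral_eq_integral) auto
      then show ?thesis using bound[of "real (Suc i)"] by (simp add: ennreal_leI)
    qed
    then show "\<forall>\<^sub>F i in sequentially. (\<integral>\<^sup>+x. ennreal (exp (T * trunc (real (Suc i)) (v x))) \<partial>\<mu>) \<le> ennreal Z"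
      by simp
  qed simp
  finally have fin: "(\<integral>\<^sup>+x. ennreal (exp (T * v x)) \<partial>\<mu>) \<le> ennreal Z" .
  have "(\<integral>\<^sup>+x. ennreal (exp (t * f x)) \<partial>\<mu>) < \<infinity>" if t: "0 < t" "t < T" for t
  proof -
    have "t * f x \<le> T * v x" for x
    proof -
      \<comment> \<open>As \<open>f\<close> may be negative, the comparison goes through
        \<open>v\<close>: first \<open>f \<le> v\<close>, then \<open>t \<le> T\<close> with
        \<open>v\<close> nonnegative.\<close>
      have "t * f x \<le> t * v x" using t a b by (simp add: v_def)
      also have "\<dots> \<le> T * v x" using t v0[of x] by (intro mult_right_mono) auto
      finally show ?thesis .
    qed
    then have "(\<integral>\<^sup>+x. ennreal (exp (t * f x)) \<partial>\<mu>) \<le> (\<integral>\<^sup>+x. ennreal (exp (T * v x)) \<partial>\<mu>)"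
      by (intro nn_integral_mono ennreal_leI) simp
    also have "\<dots> < \<infinity>" using fin le_less_trans ennreal_less_top by (metis infinity_ennreal_def)
    finally show ?thesis .
  qed
  with T(1) show ?thesis by blast
qed

end
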